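(* Let $\ell \ge 2$ be an integer and let $F$ be a strictly $\ell$-balanced $\ell$-graph such that either $F$ has exactly three edges and $\gamma(F) = \ell - 1$, or $F$ contains at least $4$ edges. Then there exist constants $c, L > 0$ such that for $p = p(n) \le c n^{-1/m_\ell(F)}$, with high probability $G \sim G^{(\ell)}(n,p)$ satisfies that every $F$-block $B \subseteq G$ contains at most $L$ vertices.
   Context: An $\ell$-graph is an $\ell$-uniform hypergraph; $v(\cdot)$ and $e(\cdot)$ denote numbers of vertices and edges. $G^{(\ell)}(n,p)$ is the random $\ell$-graph on $n$ vertices in which each $\ell$-subset of vertices is an edge independently with probability $p$. "With high probability" means with probability tending to $1$ as $n\to\infty$. For an $\ell$-graph $G$ on at least $\ell+1$ vertices, $d_\ell(G) := (e(G)-1)/(v(G)-\ell)$ and $m_\ell(G) := \max\{d_\ell(J) : J \subseteq G,\ v(J)\ge \ell+1\}$; $G$ is strictly $\ell$-balanced if $m_\ell(G) = d_\ell(G)$ and $d_\ell(J) < m_\ell(G)$ for every $J \subsetneq G$ with $v(J) \ge \ell+1$. An $F$-copy in $G$ is a subgraph of $G$ isomorphic to $F$. In the following, $F$ has at least two edges. - $\gamma(F) := \max\{|e_1 \cap e_2| : e_1, e_2 \in E(F),\ e_1 \ne e_2\}$. - Edges $e_1, e_2 \in E(G)$ are $F$-equivalent (in $G$) if for every $F$-copy $F'$ in $G$ we have $e_1 \in E(F')$ if and only if $e_2 \in E(F')$. - An edge $e \in E(G)$ is $F$-closed (in $G$) if either (a) $\gamma(F) = \ell-1$ and $e$ belongs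 to at least two $F$-copies in $G$, or (b) $\gamma(F) < \ell-1$, $e$ belongs to at least two $F$-copies in $G$, and no edge $e' \in E(G)\setminus\{e\}$ is $F$-equivalent to $e$. - An $F$-copy $F'$ in $G$ is $F$-closed if at least three edges from $E(F')$ are $F$-closed. - $G$ is $F$-closed if every vertex and every edge of $G$ belongs to at least one $F$-copy and every $F$-copy in $G$ is $F$-closed. - An $F$-block is an $F$-closed $\ell$-graph $B$ such that for every non-empty proper subset $E' \subsetneq E(B)$ there exists an $F$-copy $F'$ in $B$ with $E(F') \cap E' \ne \emptyset$ and $E(F') \setminus E' \ne \emptyset$. (For $B\subseteq G$, being an $F$-block is a property of $B$ as an $\ell$-graph in its own right.) *)

theory Defs
  imports "HOL-Probability.Probability"
begin

record 'a hypergraph =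
  verts :: "'a set"
  edges :: "'a set set"

definition uniform_graph :: "nat \<Rightarrow> 'a hypergraph \<Rightarrow> bool" where
  "uniform_graph l G \<longleftrightarrow> finite (verts G) \<and> (\<forall>e\<in>edges G. e \<subseteq> verts G \<and> card e = l)"

definition subgraph :: "'a hypergraph \<Rightarrow> 'a hypergraph \<Rightarrow> bool" where
  "subgraph H G \<longleftrightarrow> edges H \<subseteq> Pow (verts H) \<and> verts H \<subseteq> verts G \<and> edges H \<subseteq> edges G"

definition density :: "nat \<Rightarrow> 'a hypergraph \<Rightarrow> real" where
  "density l G = (real (card (edges G)) - 1) / (real (card (verts G)) - real l)"

definition max_density :: "nat \<Rightarrow> 'a hypergraph \<Rightarrow> real" where
  "max_density l G = Max {density l J | J. subgraph J G \<and> card (verts J) \<ge> l + 1}"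

definition strictly_balanced :: "nat \<Rightarrow> 'a hypergraph \<Rightarrow> bool" where
  "strictly_balanced l G \<longleftrightarrow>
     card (verts G) \<ge> l + 1 \<and>
     max_density l G = density l G \<and>
     (\<forall>J. subgraph J G \<and> J \<noteq> G \<and> card (verts J) \<ge> l + 1 \<longrightarrow> density l J < max_density l G)"

definition isomorphic :: "'a hypergraph \<Rightarrow> 'b hypergraph \<Rightarrow> bool" where
  "isomorphic G H \<longleftrightarrow>
     (\<exists>f. bij_betw f (verts G) (verts H) \<and> edges H = (\<lambda>e. f ` e) ` edges G)"

definition copies :: "'a hypergraph \<Rightarrow> 'b hypergraph \<Rightarrow> 'b hypergraph set" where
  "copies F G = {H. subgraph H G \<and> isomorphic F H}"

text \<open>Only meaningful if \<open>F\<close> has at least two edges; otherwise \<open>Max\<close> is taken of the empty set.\<close>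

definition max_intersection :: "'a hypergraph \<Rightarrow> nat" where
  "max_intersection F = Max {card (e1 \<inter> e2) | e1 e2. e1 \<in> edges F \<and> e2 \<in> edges F \<and> e1 \<noteq> e2}"

definition equivalent_edges :: "'a hypergraph \<Rightarrow> 'b hypergraph \<Rightarrow> 'b set \<Rightarrow> 'b set \<Rightarrow> bool" where
  "equivalent_edges F G e1 e2 \<longleftrightarrow>
     e1 \<in> edges G \<and> e2 \<in> edges G \<and> (\<forall>H\<in>copies F G. e1 \<in> edges H \<longleftrightarrow> e2 \<in> edges H)"

text \<open>The notions below are intended for \<open>l\<close>-uniform \<open>F\<close> and \<open>G\<close>. In particular \<open>G\<close> is then
  finite, so the cardinalities below are those of finite sets.\<close>

definition closed_edge :: "nat \<Rightarrow> 'a hypergraph \<Rightarrow> 'b hypergraph \<Rightarrow> 'b set \<Rightarrow> bool" where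
  "closed_edge l F G e \<longleftrightarrow>
     e \<in> edges G \<and>
     (max_intersection F = l - 1 \<and> card {H \<in> copies F G. e \<in> edges H} \<ge> 2 \<or>
      max_intersection F < l - 1 \<and> card {H \<in> copies F G. e \<in> edges H} \<ge> 2 \<and>
        \<not> (\<exists>e'\<in>edges G - {e}. equivalent_edges F G e' e))"

definition closed_copy :: "nat \<Rightarrow> 'a hypergraph \<Rightarrow> 'b hypergraph \<Rightarrow> 'b hypergraph \<Rightarrow> bool" where
  "closed_copy l F G H \<longleftrightarrow> H \<in> copies F G \<and> card {e \<in> edges H. closed_edge l F G e} \<ge> 3"

definition closed_graph :: "nat \<Rightarrow> 'a hypergraph \<Rightarrow> 'b hypergraph \<Rightarrow> bool" where
  "closed_graph l F G \<longleftrightarrow>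
     (\<forall>v\<in>verts G. \<exists>H\<in>copies F G. v \<in> verts H) \<and>
     (\<forall>e\<in>edges G. \<exists>H\<in>copies F G. e \<in> edges H) \<and>
     (\<forall>H\<in>copies F G. closed_copy l F G H)"

definition block :: "nat \<Rightarrow> 'a hypergraph \<Rightarrow> 'b hypergraph \<Rightarrow> bool" where
  "block l F B \<longleftrightarrow>
     uniform_graph l B \<and> closed_graph l F B \<and>
     (\<forall>E'. E' \<noteq> {} \<and> E' \<subset> edges B \<longrightarrow>
        (\<exists>H\<in>copies F B. edges H \<inter> E' \<noteq> {} \<and> edges H - E' \<noteq> {}))"

definition random_graph :: "nat \<Rightarrow> nat \<Rightarrow> real \<Rightarrow> nat hypergraph pmf" where
  "random_graph l n p =
     (let S = {e. e \<subseteq> {..<n} \<and> card e = l}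
      in map_pmf (\<lambda>X. \<lparr>verts = {..<n}, edges = {e \<in> S. X e}\<rparr>)
           (Pi_pmf S False (\<lambda>_. bernoulli_pmf p)))"

end

theory Submission
  imports Defs "HOL-Real_Asymp.Real_Asymp"
begin

text \<open>
  Explore a block \<open>B\<close> by adding \<open>F\<close>-copies one at a time, starting from a single copy. Whenever
  some copy found so far is not yet closed in the part explored, one of its edges lies in a further
  copy in \<open>B\<close>, and such a copy is added next; otherwise any copy meeting the explored part will do.
  A step is regular if the new copy meets the explored part in exactly one edge, and degenerate
  otherwise. By strict balancedness a degenerate step costs a factor \<open>n\<close> to a negative power in the
  expected number of explorations, so only a bounded number of them occur. A regular step costs only a
  small constant factor, which excludes long explorations, but it produces a pendant copy, one
  that meets the rest in at most one edge; pendant copies are not closed. Counting pendant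
  copies shows that the length of an exploration in which all copies are closed is linear in the number
  of degenerate steps, hence bounded.
\<close>

subsection \<open>Copies sharing one edge with the rest\<close>

text \<open>The main obstacle is that a regular step saves only the constant factor
  \<open>c\<close>, so the number of places where the next copy may be attached must not grow with
  the length of the exploration. Attaching only to one unclosed copy achieves this; the whole
  explored part serves as a base only when all its copies are closed, and then its size is already
  bounded in terms of the degenerate steps. Degenerate steps may use the whole explored part. They
  save n^(-\<alpha>), and half of this exponent pays for choosing vertices in an explored part of
  polynomial size. Explorations are followed for about n^\<beta> steps, so that halving the weight
  at each step beats the polynomial number of first copies. Requiring three closed edges is what
  makes regular steps leave a trace: a copy attached at one edge, to which one further copy is
  attached at one edge, has no closed edges besides these two. Without tightness, this rests on an
  equivalent partner edge, which exists because \<open>F\<close> has at least four edges.\<close>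

text \<open>
  A copy of \<open>F\<close> is represented by its edge set: no copy has isolated vertices. Here \<open>m\<close> stands for
  the maximal density and \<open>tight\<close> for the case \<open>\<gamma>(F) = l - 1\<close>.
\<close>

locale balanced_family =
  fixes l :: nat and F :: "'a set set" and m :: real and tight :: bool
  assumes l_pos: "1 \<le> l"
    and uniform_F: "\<And>e. e \<in> F \<Longrightarrow> card e = l"
    and m_pos: "0 < m"
    and balanced: "\<And>J. J \<subseteq> F \<Longrightarrow> J \<noteq> {} \<Longrightarrow> real (card J) - 1 \<le> m * (real (card (\<Union>J)) - real l)"
    and strictly: "\<And>J. J \<subset> F \<Longrightarrow> 2 \<le> card J \<Longrightarrow> real (card J) - 1 < m * (real (card (\<Union>J)) - real l)"
    and density_F: "real (card F) - 1 = m * (real (card (\<Union>F)) - real l)"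
    and three_edges: "3 \<le> card F"
    and four_edges: "\<not> tight \<Longrightarrow> 4 \<le> card F"
    and tight_density: "tight \<Longrightarrow> 1 \<le> m"
begin

definition is_copy :: "'b set set \<Rightarrow> bool" where
  "is_copy H \<longleftrightarrow> (\<exists>\<phi>. inj_on \<phi> (\<Union>F) \<and> H = (`) \<phi> ` F)"

definition copies_in :: "'b set set \<Rightarrow> 'b set set set" where
  "copies_in X = {H. H \<subseteq> X \<and> is_copy H}"

definition closed_in :: "'b set set \<Rightarrow> 'b set \<Rightarrow> bool" where
  "closed_in X e \<longleftrightarrow> e \<in> X \<and> 2 \<le> card {H \<in> copies_in X. e \<in> H} \<and>
     (tight \<or> \<not> (\<exists>e'\<in>X - {e}. \<forall>H\<in>copies_in X. e' \<in> H \<longleftrightarrow> e \<in> H))"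

definition copy_closed_in :: "'b set set \<Rightarrow> 'b set set \<Rightarrow> bool" where
  "copy_closed_in X H \<longleftrightarrow> 3 \<le> card {e \<in> H. closed_in X e}"

definition attached :: "'b set set \<Rightarrow> 'b set set \<Rightarrow> 'b set \<Rightarrow> bool" where
  "attached X C c \<longleftrightarrow> is_copy C \<and> c \<in> X \<and> c \<in> C \<and> \<Union>C \<inter> \<Union>X \<subseteq> c"

definition pendants :: "'b set set set \<Rightarrow> 'b set set set" where
  "pendants S = {A \<in> S. \<exists>a. attached (\<Union>(S - {A})) A a}"

lemma finite_F: "finite F"
  using three_edges card.infinite by fastforce

lemma finite_Union_F: "finite (\<Union>F)"
  using finite_F uniform_F l_pos by (intro finite_Union) (auto intro!: card_ge_0_finite)

lemma copy_card: assumes "is_copy H" shows "card H = card F" "finite H" "card (\<Union>H) = card (\<Union>F)"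
  "finite (\<Union>H)"
proof -
  obtain \<phi> where i: "inj_on \<phi> (\<Union>F)" and H: "H = (`) \<phi> ` F"
    using assms(1) unfolding is_copy_def by auto
  show "card H = card F" unfolding H
    by (intro card_image inj_on_image i)
  show "finite H" using H finite_F by simp
  have U: "\<Union>H = \<phi> ` \<Union>F" using H by blast
  show "card (\<Union>H) = card (\<Union>F)" unfolding U by (rule card_image[OF i])
  show "finite (\<Union>H)" unfolding U using finite_Union_F by simp
qed

text \<open>Pulling a set of edges back along the embedding preserves its edge and vertex counts, so
  the density inequalities assumed for subsets of \<open>F\<close> carry over to every copy.\<close>

lemma copy_transfer:
  assumes "is_copy H" "J \<subseteq> H"
  shows "\<exists>J'\<subseteq>F. card J = card J' \<and> card (\<Union>J) = card (\<Union>J') \<and> (J = H \<longleftrightarrow> J' = F)"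
proof -
  obtain \<phi> where i: "inj_on \<phi> (\<Union>F)" and H: "H = (`) \<phi> ` F"
    using assms(1) unfolding is_copy_def by auto
  obtain J' where J': "J' \<subseteq> F" "J = (`) \<phi> ` J'" using assms(2) H by (meson subset_imageE)
  have "inj_on ((`) \<phi>) F" by (intro inj_on_image i)
  then have 1: "card J = card J'" "J = H \<longleftrightarrow> J' = F"
    using J' H by (auto simp: card_image inj_on_subset inj_on_image_eq_iff)
  have "\<Union>J = \<phi> ` \<Union>J'" using J' by blast
  then have "card (\<Union>J) = card (\<Union>J')"
    using i J' by (metis Union_mono card_image inj_on_subset)
  then show ?thesis using 1 J' by blast
qed

lemma copy_edge_card: assumes "is_copy H" "e \<in> H" shows "card e = l" "finite e"
proof -
  obtain \<phi> where i: "inj_on \<phi> (\<Union>F)" and H: "H = (`) \<phi> ` F"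
    using assms(1) unfolding is_copy_def by auto
  then obtain f where f: "f \<in> F" "e = \<phi> ` f" using assms by blast
  then have "card e = card f" using i by (metis Union_upper card_image inj_on_subset)
  then show "card e = l" using uniform_F f by simp
  then show "finite e" using l_pos by (metis card.infinite not_one_le_zero)
qed

lemma copy_balanced:
  assumes "is_copy H" "J \<subseteq> H" "J \<noteq> {}"
  shows "real (card J) - 1 \<le> m * (real (card (\<Union>J)) - real l)"
proof -
  obtain J' where J': "J' \<subseteq> F" "card J = card J'" "card (\<Union>J) = card (\<Union>J')"
    using copy_transfer assms by blast
  have "finite J" using assms copy_card(2) finite_subset by blast
  then have "J' \<noteq> {}" using J'(2) assms(3) by auto
  then show ?thesis using balanced[OF J'(1)] J' by simp
qed

lemma copy_strictly:
  assumes "is_copy H" "J \<subset> H" "2 \<le> card J"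
  shows "real (card J) - 1 < m * (real (card (\<Union>J)) - real l)"
proof -
  obtain J' where J': "J' \<subseteq> F" "card J = card J'" "card (\<Union>J) = card (\<Union>J')" "J' \<noteq> F"
    using copy_transfer assms by (metis psubset_eq)
  then show ?thesis using strictly[of J'] assms(3) by auto
qed

lemma copy_density:
  assumes "is_copy H"
  shows "real (card H) - 1 = m * (real (card (\<Union>H)) - real l)"
  using density_F copy_card[OF assms] by simp

lemma attached_disjoint:
  assumes "attached X C c"
  shows "X \<inter> C = {c}"
proof -
  have "g = c" if "g \<in> X" "g \<in> C" for g
  proof -
    have "g \<subseteq> c" using that assms unfolding attached_def by blast
    moreover have "card g = l" "card c = l" "finite c"
      using copy_edge_card assms that unfolding attached_def by blast+
    ultimately show ?thesis by (simp add: card_subset_eq)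
  qed
  then show ?thesis using assms unfolding attached_def by blast
qed

text \<open>
  Adding the densities of the two parts of \<open>H\<close> (the part in \<open>C\<close> being completed by \<open>c\<close>) leaves no
  slack, so strict balancedness forces one part to be a single edge and the other one to be \<open>C - {c}\<close>.
\<close>

lemma copies_in_attached:
  assumes at: "attached X C c" and H: "H \<in> copies_in (X \<union> C)" "\<not> H \<subseteq> X"
  shows "\<exists>f\<in>X. H = insert f (C - {c}) \<and> (f \<noteq> c \<longrightarrow> \<not> (\<exists>K. is_copy K \<and> c \<in> K \<and> f \<in> K)) \<and>
    (tight \<longrightarrow> f = c)"
proof -
  have C: "is_copy C" "c \<in> X" "c \<in> C" "\<Union>C \<inter> \<Union>X \<subseteq> c" using at unfolding attached_def by auto
  have cH: "is_copy H" and HX: "H \<subseteq> X \<union> C" using H unfolding copies_in_def by auto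
  note cc = copy_card[OF C(1)] and hc = copy_card[OF cH]
  have cardc: "card c = l" "finite c" using copy_edge_card C by auto
  have XC: "X \<inter> C = {c}" by (rule attached_disjoint[OF at])
  define H1 where "H1 = H \<inter> X"
  define H2 where "H2 = H - X"
  have H2C: "H2 \<subseteq> C - {c}" using HX C(2) unfolding H2_def by blast
  have H2ne: "H2 \<noteq> {}" using H H2_def by blast
  have H12: "H = H1 \<union> H2" "H1 \<inter> H2 = {}" unfolding H1_def H2_def by auto
  have fin: "finite H1" "finite H2" "finite (\<Union>H1)" "finite (\<Union>H2)"
    using hc by (auto simp: H1_def H2_def intro: finite_subset[of _ "\<Union>H"])
  have H1ne: "H1 \<noteq> {}"
  proof
    assume "H1 = {}"
    then have "card H \<le> card (C - {c})" using H12 H2C cc by (metis Un_empty_left card_mono finite_Diff)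
    also have "\<dots> < card C" using C(3) cc by (meson card_Diff1_less)
    finally show False using cc hc by simp
  qed
  define J where "J = insert c H2"
  have JC: "J \<subseteq> C" using J_def H2C C by blast
  have cardJ: "card J = card H2 + 1" using J_def H2C fin by (metis card_insert_disjoint DiffD2 Suc_eq_plus1 insertI1 subsetD)
  have cardH: "card H = card H1 + card H2" using H12 fin by (metis card_Un_disjoint)
  have UJ: "\<Union>J = c \<union> (\<Union>H2 - c)" using J_def by blast
  have cUJ: "card (\<Union>J) = l + card (\<Union>H2 - c)"
    unfolding UJ using cardc fin by (subst card_Un_disjoint) auto
  have UH: "\<Union>H = \<Union>H1 \<union> (\<Union>H2 - \<Union>H1)" using H12 by blast
  have cUH: "card (\<Union>H) = card (\<Union>H1) + card (\<Union>H2 - \<Union>H1)"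
    unfolding UH using fin by (subst card_Un_disjoint) auto
  have sub: "\<Union>H2 - c \<subseteq> \<Union>H2 - \<Union>H1"
    using H2C C(4) unfolding H1_def by blast
  then have le: "card (\<Union>H2 - c) \<le> card (\<Union>H2 - \<Union>H1)" using fin by (simp add: card_mono)
  have b1: "real (card H1) - 1 \<le> m * (real (card (\<Union>H1)) - real l)"
    using copy_balanced[OF cH] H12 H1ne by blast
  have b2: "real (card J) - 1 \<le> m * (real (card (\<Union>J)) - real l)"
    using copy_balanced[OF C(1) JC] J_def by blast
  have tot: "real (card H) - 1 = m * (real (card (\<Union>H)) - real l)" by (rule copy_density[OF cH])
  \<comment> \<open>\<open>x\<close> counts the vertices of the new edges that lie in
    \<open>c\<close> but outside the old part of \<open>H\<close>. It is the surplus that appears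
    when the densities of the two parts are added.\<close>
  define x where "x = real (card (\<Union>H2 - \<Union>H1)) - real (card (\<Union>H2 - c))"
  have x0: "0 \<le> x" using le x_def by simp
  have tot': "real (card H1) - 1 + (real (card J) - 1)
      = m * (real (card (\<Union>H1)) - real l) + m * (real (card (\<Union>J)) - real l) + m * x"
    using tot cardH cardJ cUJ cUH unfolding x_def by (simp add: algebra_simps)
  have mx: "0 \<le> m * x" using x0 m_pos by simp
  have x: "m * x = 0" using tot' mx b1 b2 by linarith
  have "H1 \<subset> H" using H12 H2ne by blast
  then have "\<not> 2 \<le> card H1"
    using copy_strictly[OF cH, of H1] tot' b2 mx by linarith
  then have "card H1 = 1" using H1ne fin by (metis One_nat_def Suc_1 card_eq_0_iff le_SucE not_less_eq_eq le_0_eq nat_le_linear)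
  then obtain f where f: "H1 = {f}" using card_1_singletonE by blast
  have "2 \<le> card J" using cardJ H2ne fin by (simp add: Suc_leI card_gt_0_iff)
  then have JC': "J = C" using copy_strictly[OF C(1), of J] JC tot' b1 mx by fastforce
  then have H2': "H2 = C - {c}" using J_def H2C by blast
  have fX: "f \<in> X" using f H1_def by blast
  have Heq: "H = insert f (C - {c})" using H12 f H2' by blast
  \<comment> \<open>\<open>T\<close> consists of the vertices of \<open>c\<close> used by the other
    edges of \<open>C\<close>. Since \<open>x\<close> vanishes, \<open>f\<close> contains
    \<open>T\<close>; strictness for \<open>C - {c}\<close> shows that \<open>c\<close> has fewer
    than 1/m vertices outside \<open>T\<close>.\<close>
  define T where "T = \<Union>H2 \<inter> c"
  have Tf: "T \<subseteq> f"
  proof -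
    have "x = 0" using x m_pos by simp
    then have "card (\<Union>H2 - c) = card (\<Union>H2 - f)" using f x_def by simp
    then have "\<Union>H2 - c = \<Union>H2 - f" using sub f fin by (metis card_subset_eq finite_Diff ccpo_Sup_singleton)
    then show ?thesis using T_def by blast
  qed
  have cardC: "card C = card H2 + 1" using cardJ JC' by simp
  have "C - {c} \<subset> C" "2 \<le> card (C - {c})" using C(3) cardC cc three_edges H2' by auto
  from copy_strictly[OF C(1) this] have s: "real (card H2) - 1 < m * (real (card (\<Union>H2)) - real l)"
    using H2' by simp
  have "card (\<Union>H2) = card (\<Union>H2 - c) + card T"
    unfolding T_def using fin by (metis add.commute card_Int_Diff)
  moreover have "real (card C) - 1 = m * (real (card (\<Union>C)) - real l)" by (rule copy_density[OF C(1)])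
  moreover have "card (\<Union>C) = l + card (\<Union>H2 - c)" using cUJ JC' by simp
  ultimately have mT: "m * (real l - real (card T)) < 1"
    using s cardC by (simp add: algebra_simps)
  have cf: "card f = l" "finite f" using copy_edge_card[OF cH, of f] Heq by auto
  \<comment> \<open>In a common copy, balancedness of the pair would force at least 1/m vertices of
    \<open>c\<close> outside \<open>f\<close>, too many since \<open>f\<close> contains
    \<open>T\<close>.\<close>
  have A: "\<not> (\<exists>K. is_copy K \<and> c \<in> K \<and> f \<in> K)" if "f \<noteq> c"
  proof
    assume "\<exists>K. is_copy K \<and> c \<in> K \<and> f \<in> K"
    then obtain K where K: "is_copy K" "c \<in> K" "f \<in> K" by blast
    have "real (card {c,f}) - 1 \<le> m * (real (card (\<Union>{c,f})) - real l)"
      using copy_balanced[OF K(1), of "{c,f}"] K by blast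
    then have 1: "1 \<le> m * (real (card (c \<union> f)) - real l)" using that by simp
    have "card (c \<union> f) + card (c \<inter> f) = l + l" using cf cardc by (metis card_Un_Int)
    moreover have "card T \<le> card (c \<inter> f)" using Tf cf by (intro card_mono) (auto simp: T_def)
    ultimately have "real (card (c \<union> f)) - real l \<le> real l - real (card T)" by linarith
    then have "m * (real (card (c \<union> f)) - real l) \<le> m * (real l - real (card T))"
      using m_pos by simp
    then show False using 1 mT by linarith
  qed
  \<comment> \<open>As \<open>1 \<le> m\<close>, fewer than 1/m vertices means none, so
    \<open>T\<close> is all of \<open>c\<close>.\<close>
  moreover have "f = c" if tight
  proof -
    have Tc: "T \<subseteq> c" using T_def by blast
    then have Tl: "card T \<le> l" using cardc by (metis card_mono)
    have "card T = l"
    proof (rule ccontr)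
      assume "card T \<noteq> l"
      then have "1 \<le> real l - real (card T)" using Tl by linarith
      then have "1 * 1 \<le> m * (real l - real (card T))"
        using tight_density[OF that] by (intro mult_mono) auto
      then show False using mT by simp
    qed
    then have "T = c" using Tc cardc by (metis card_subset_eq)
    then show ?thesis using Tf cf cardc by (metis card_subset_eq)
  qed
  ultimately show ?thesis using fX Heq by blast
qed

text \<open>By \<open>copies_in_attached\<close>, a copy contains an edge of \<open>C - {c}\<close>
  only if it is not inside \<open>X\<close>, and then it contains all of \<open>C - {c}\<close>.
  These edges are thus mutually equivalent, and in the tight case \<open>C\<close> is the only copy
  through them.\<close>

lemma not_closed_of_attached:
  assumes at: "attached X C c" and g: "g \<in> C" "g \<noteq> c"
  shows "\<not> closed_in (X \<union> C) g"
proof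
  assume cl: "closed_in (X \<union> C) g"
  have cC: "is_copy C" using at unfolding attached_def by blast
  have XC: "X \<inter> C = {c}" by (rule attached_disjoint[OF at])
  have char: "H \<in> copies_in (X \<union> C) \<Longrightarrow> g' \<in> C - {c} \<Longrightarrow> g' \<in> H \<longleftrightarrow> \<not> H \<subseteq> X" for H g'
    using copies_in_attached[OF at, of H] XC by blast
  show False
  proof (cases tight)
    case True
    have "H = C" if H: "H \<in> copies_in (X \<union> C)" "g \<in> H" for H
    proof -
      have "\<not> H \<subseteq> X" using char[OF H(1)] g H(2) by simp
      then have "H = insert c (C - {c})" using copies_in_attached[OF at H(1)] True by auto
      then show "H = C" using XC by blast
    qed
    then have "{H \<in> copies_in (X \<union> C). g \<in> H} \<subseteq> {C}" by blast
    then have "card {H \<in> copies_in (X \<union> C). g \<in> H} \<le> card {C}" by (intro card_mono) auto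
    then show False using cl unfolding closed_in_def by simp
  next
    case False
    have "card {c,g} < card C" using four_edges[OF False] copy_card[OF cC] g by simp
    then have "\<not> C \<subseteq> {c,g}" by (meson card_mono finite.emptyI finite.insertI not_less)
    then obtain g' where g': "g' \<in> C" "g' \<noteq> c" "g' \<noteq> g" by blast
    then have "\<forall>H\<in>copies_in (X \<union> C). g' \<in> H \<longleftrightarrow> g \<in> H" using char g by auto
    then show False using cl g' False unfolding closed_in_def by blast
  qed
qed

lemma not_copy_closed_of_attached:
  assumes at: "attached X C c"
  shows "\<not> copy_closed_in (X \<union> C) C"
proof -
  have "{e \<in> C. closed_in (X \<union> C) e} \<subseteq> {c}" using not_closed_of_attached[OF at] by blast
  then have "card {e \<in> C. closed_in (X \<union> C) e} \<le> card {c}" by (intro card_mono) auto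
  then show ?thesis unfolding copy_closed_in_def by simp
qed

text \<open>Only \<open>a\<close> and \<open>c\<close> can be closed edges of \<open>A\<close>. A
  copy that is new with \<open>C\<close> has the form \<open>insert f (C - {c})\<close>; it could
  contain an edge of \<open>A\<close> other than \<open>c\<close> only as \<open>f\<close>, but
  \<open>f\<close> and \<open>c\<close> share no copy, whereas the edges of \<open>A\<close> share
  \<open>A\<close>. So the copies through the remaining edges of \<open>A\<close> are those from
  before, when \<open>A\<close> was attached to \<open>Y\<close>.\<close>

lemma not_copy_closed_after_attaching:
  assumes aA: "attached Y A a" and aC: "attached (Y \<union> A) C c" and cA: "c \<in> A"
  shows "\<not> copy_closed_in (Y \<union> A \<union> C) A"
proof -
  define X where "X = Y \<union> A"
  have cpA: "is_copy A" using aA unfolding attached_def by blast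
  have YA: "Y \<inter> A = {a}" by (rule attached_disjoint[OF aA])
  have XC: "X \<inter> C = {c}" unfolding X_def by (rule attached_disjoint[OF aC])
  have inX: "H \<in> copies_in X" if "H \<in> copies_in (X \<union> C)" "g \<in> A" "g \<noteq> c" "g \<in> H" for H g
  proof (rule ccontr)
    assume "H \<notin> copies_in X"
    then have "\<not> H \<subseteq> X" using that unfolding copies_in_def by auto
    from copies_in_attached[OF aC[folded X_def] that(1) this]
    obtain f where f: "H = insert f (C - {c})" "f \<noteq> c \<Longrightarrow> \<not> (\<exists>K. is_copy K \<and> c \<in> K \<and> f \<in> K)" by blast
    have "g \<in> X" using that X_def by blast
    then have "g = f" using f(1) that XC by blast
    then show False using f(2) that cA cpA by blast
  qed
  have char: "g \<in> H \<longleftrightarrow> H \<in> copies_in X \<and> \<not> H \<subseteq> Y"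
    if "H \<in> copies_in (X \<union> C)" "g \<in> A" "g \<noteq> c" "g \<noteq> a" for H g
    using inX[OF that(1-3)] copies_in_attached[OF aA, of H, folded X_def] YA that by blast
  have "\<not> closed_in (X \<union> C) g" if g: "g \<in> A" "g \<noteq> c" "g \<noteq> a" for g
  proof
    assume cl: "closed_in (X \<union> C) g"
    show False
    proof (cases tight)
      case True
      have "H = A" if H: "H \<in> copies_in (X \<union> C)" "g \<in> H" for H
      proof -
        have "H \<in> copies_in X" "\<not> H \<subseteq> Y" using char[OF H(1) g] H(2) by auto
        then have "H = insert a (A - {a})"
          using copies_in_attached[OF aA, of H, folded X_def] True by auto
        then show "H = A" using YA by blast
      qed
      then have "{H \<in> copies_in (X \<union> C). g \<in> H} \<subseteq> {A}" by blast
      then have "card {H \<in> copies_in (X \<union> C). g \<in> H} \<le> card {A}" by (intro card_mono) auto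
      then show False using cl unfolding closed_in_def by simp
    next
      case False
      \<comment> \<open>A fourth edge provides a partner of \<open>g\<close> that differs from both
        \<open>a\<close> and \<open>c\<close> and lies in the same copies.\<close>
      have "card {a,c,g} \<le> 3" by (simp add: card_insert_if)
      then have "card {a,c,g} < card A" using four_edges[OF False] copy_card[OF cpA] by simp
      then have "\<not> A \<subseteq> {a,c,g}" by (meson card_mono finite.emptyI finite.insertI not_less)
      then obtain g' where g': "g' \<in> A" "g' \<noteq> c" "g' \<noteq> g" "g' \<noteq> a" by blast
      then have "\<forall>H\<in>copies_in (X \<union> C). g' \<in> H \<longleftrightarrow> g \<in> H" using char g by auto
      then show False using cl g' False X_def unfolding closed_in_def by blast
    qed
  qed
  then have "{e \<in> A. closed_in (X \<union> C) e} \<subseteq> {a,c}" by blast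
  then have "card {e \<in> A. closed_in (X \<union> C) e} \<le> card {a,c}" by (intro card_mono) auto
  also have "\<dots> \<le> 2" by (simp add: card_insert_if)
  finally show ?thesis unfolding copy_closed_in_def X_def by simp
qed

subsection \<open>Exploring a block copy by copy\<close>

definition open_copies :: "'b set set set \<Rightarrow> 'b set set set" where
  "open_copies S = {T \<in> S. \<not> copy_closed_in (\<Union>S) T}"

text \<open>
  Non-pendant targets are preferred so that a pendant target, once a copy has been attached to it,
  cannot be followed by another pendant target before it is closed. This is what makes the
  correction term of the potential work.
\<close>

definition target :: "'b set set set \<Rightarrow> 'b set set" where
  "target S = (SOME T. T \<in> open_copies S \<and> (T \<in> pendants S \<longrightarrow> open_copies S \<subseteq> pendants S))"

text \<open>The two cases keep the number of possible attachment edges bounded independently of the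
  number of steps; see \<open>card_base\<close>.\<close>

definition base :: "'b set set set \<Rightarrow> 'b set set" where
  "base S = (if open_copies S = {} then \<Union>S else target S)"

text \<open>Attaching a copy to a pendant target may trade one pendant copy for another and leave
  their number unchanged. The correction then changes from 1 to 0, which still counts as progress.
  The factor 2 makes a genuinely additional pendant copy outweigh any change of the
  correction.\<close>

definition potential :: "'b set set set \<Rightarrow> int" where
  "potential S = 2 * int (card (pendants S)) -
     (if open_copies S \<noteq> {} \<and> target S \<in> pendants S then 1 else 0)"

lemma target:
  assumes "open_copies S \<noteq> {}"
  shows "target S \<in> open_copies S" "target S \<in> pendants S \<Longrightarrow> open_copies S \<subseteq> pendants S"
proof -
  have "\<exists>T. T \<in> open_copies S \<and> (T \<in> pendants S \<longrightarrow> open_copies S \<subseteq> pendants S)"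
    using assms by blast
  from someI_ex[OF this]
  show "target S \<in> open_copies S" "target S \<in> pendants S \<Longrightarrow> open_copies S \<subseteq> pendants S"
    unfolding target_def[symmetric] by auto
qed

lemma base_subset: "base S \<subseteq> \<Union>S"
  using target(1)[of S] unfolding base_def open_copies_def by auto

lemma finite_pendants: "finite S \<Longrightarrow> finite (pendants S)"
  unfolding pendants_def by simp

lemma pendants_open: "pendants S \<subseteq> open_copies S"
proof
  fix A assume "A \<in> pendants S"
  then obtain a where a: "A \<in> S" "attached (\<Union>(S - {A})) A a" unfolding pendants_def by blast
  have "\<Union>(S - {A}) \<union> A = \<Union>S" using a by blast
  then show "A \<in> open_copies S"
    using not_copy_closed_of_attached[OF a(2)] a(1) unfolding open_copies_def by simp
qed

lemma potential_all_closed: "open_copies S = {} \<Longrightarrow> potential S = 0"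
  using pendants_open[of S] unfolding potential_def by simp

text \<open>The shared edge already has \<open>l\<close> vertices, so the numerical condition for a
  regular step leaves room for no other shared vertex.\<close>

lemma attachedI:
  assumes "is_copy C" "c \<in> C" "c \<in> X" "card (\<Union>C \<inter> \<Union>X) \<le> l"
  shows "attached X C c"
proof -
  have "c \<subseteq> \<Union>C \<inter> \<Union>X" using assms by blast
  moreover have "finite (\<Union>C \<inter> \<Union>X)" using copy_card(4)[OF assms(1)] by blast
  moreover have "card c = l" using copy_edge_card assms by blast
  ultimately have "c = \<Union>C \<inter> \<Union>X" using assms(4) by (simp add: card_seteq)
  then show ?thesis using assms unfolding attached_def by blast
qed

lemma attached_insert:
  assumes "attached (\<Union>(S - {A})) A a" "\<Union>A \<inter> \<Union>C \<subseteq> a" "C \<noteq> A"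
  shows "attached (\<Union>(insert C S - {A})) A a"
  using assms unfolding attached_def by blast

text \<open>The new copy is pendant and can destroy no pendant copy except the target. If the target
  stays pendant or was not pendant, the count grows; otherwise the correction term disappears. If
  all copies were closed, the potential was 0.\<close>

lemma potential_regular:
  assumes fS: "finite S" and C: "is_copy C" "\<not> C \<subseteq> \<Union>S" "C \<inter> base S \<noteq> {}"
    and reg: "card (\<Union>C \<inter> \<Union>(\<Union>S)) \<le> l"
  shows "potential S + 1 \<le> potential (insert C S)"
proof -
  obtain c where c: "c \<in> C" "c \<in> base S" using C by blast
  have cX: "c \<in> \<Union>S" using c base_subset by blast
  have at: "attached (\<Union>S) C c" by (rule attachedI[OF C(1) c(1) cX reg])
  have CS: "C \<notin> S" using C by blast
  then have "insert C S - {C} = S" by blast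
  then have new: "C \<in> pendants (insert C S)" using at unfolding pendants_def by auto
  have UC: "\<Union>(insert C S) = \<Union>S \<union> C" by blast
  have CX: "\<Union>C \<inter> \<Union>(\<Union>S) \<subseteq> c" using at unfolding attached_def by blast
  note fin = finite_pendants[OF fS] finite_pendants[of "insert C S"] fS
  have Cn: "C \<notin> pendants S" using CS unfolding pendants_def by blast
  show ?thesis
  proof (cases "open_copies S = {}")
    case True
    then have "potential S = 0" by (rule potential_all_closed)
    moreover have "1 \<le> card (pendants (insert C S))"
      using new fin by (metis One_nat_def Suc_leI card_gt_0_iff empty_iff finite_insert)
    ultimately show ?thesis unfolding potential_def by simp
  next
    case False
    define T where "T = target S"
    have T: "T \<in> S" "\<not> copy_closed_in (\<Union>S) T"
      using target(1)[OF False] unfolding T_def open_copies_def by auto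
    have cT: "c \<in> T" using c False unfolding base_def T_def by simp
    \<comment> \<open>\<open>C\<close> meets the explored part only inside \<open>c\<close>, and
      \<open>c\<close> belongs to the other copy \<open>T\<close>, so \<open>A\<close> meets
      \<open>c\<close> only inside its own attaching edge.\<close>
    have keep: "A \<in> pendants (insert C S)" if A: "A \<in> pendants S" "A \<noteq> T" for A
    proof -
      obtain a where a: "A \<in> S" "attached (\<Union>(S - {A})) A a" using A unfolding pendants_def by blast
      have "c \<in> \<Union>(S - {A})" using T cT A by blast
      then have "\<Union>A \<inter> c \<subseteq> a" using a(2) unfolding attached_def by blast
      moreover have "\<Union>A \<inter> \<Union>C \<subseteq> c" using CX a(1) by blast
      ultimately have "\<Union>A \<inter> \<Union>C \<subseteq> a" by blast
      then show ?thesis using attached_insert[OF a(2)] a(1) CS unfolding pendants_def by blast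
    qed
    have c1: "card (pendants S) + 1 \<le> card (pendants (insert C S))"
      if "pendants S \<subseteq> pendants (insert C S)"
    proof -
      have "card (insert C (pendants S)) \<le> card (pendants (insert C S))"
        using that new fin by (intro card_mono) auto
      then show ?thesis using Cn fin by simp
    qed
    show ?thesis
    proof (cases "T \<in> pendants S \<and> T \<notin> pendants (insert C S)")
      case False
      then have "pendants S \<subseteq> pendants (insert C S)" using keep by blast
      then have le: "card (pendants S) + 1 \<le> card (pendants (insert C S))" by (rule c1)
      have sub: "T \<in> pendants S \<Longrightarrow> T \<in> pendants (insert C S)" using False by blast
      show ?thesis
        using le \<open>open_copies S \<noteq> {}\<close> unfolding potential_def T_def[symmetric]
        by (auto split: if_splits)
    next
      case True
      \<comment> \<open>\<open>C\<close> replaces \<open>T\<close> in the count. As \<open>T\<close>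
        stays open but is no longer pendant, the preference rule makes the next target
        non-pendant.\<close>
      have "card (insert C (pendants S - {T})) \<le> card (pendants (insert C S))"
        using keep new fin by (intro card_mono) auto
      then have le: "card (pendants S) \<le> card (pendants (insert C S))"
        using Cn fin True by (simp add: card_Diff_singleton card_insert_if split: if_splits)
      obtain a where a: "attached (\<Union>(S - {T})) T a" using True unfolding pendants_def by blast
      have US: "\<Union>(S - {T}) \<union> T = \<Union>S" using T by blast
      have "\<not> copy_closed_in (\<Union>(S - {T}) \<union> T \<union> C) T"
        by (rule not_copy_closed_after_attaching[OF a _ cT]) (simp only: US at)
      then have "T \<in> open_copies (insert C S)"
        using T unfolding open_copies_def UC US by blast
      then have "\<not> target (insert C S) \<in> pendants (insert C S)"
        using target(2)[of "insert C S"] True by blast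
      then show ?thesis using le True \<open>open_copies S \<noteq> {}\<close>
        unfolding potential_def T_def[symmetric] by simp
    qed
  qed
qed

text \<open>
  Distinct pendant copies destroyed by \<open>C\<close> are met by \<open>C\<close> in distinct vertices.
\<close>

lemma potential_any:
  assumes fS: "finite S" and C: "is_copy C" "C \<notin> S"
  shows "potential S - (2 * int (card (\<Union>F)) + 1) \<le> potential (insert C S)"
proof -
  define K where "K = pendants S - pendants (insert C S)"
  define w where "w A = (SOME x. x \<in> \<Union>A \<inter> \<Union>C \<and> (\<forall>B\<in>S - {A}. x \<notin> \<Union>B))" for A
  have w: "w A \<in> \<Union>A \<inter> \<Union>C \<and> (\<forall>B\<in>S - {A}. w A \<notin> \<Union>B)" if AK: "A \<in> K" for A
  proof -
    obtain a where a: "A \<in> S" "attached (\<Union>(S - {A})) A a"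
      using AK unfolding K_def pendants_def by blast
    have "\<not> \<Union>A \<inter> \<Union>C \<subseteq> a"
      using attached_insert[OF a(2), of C] a(1) that C unfolding K_def pendants_def by blast
    then obtain x where x: "x \<in> \<Union>A \<inter> \<Union>C" "x \<notin> a" by blast
    have "\<forall>B\<in>S - {A}. x \<notin> \<Union>B" using x a(2) unfolding attached_def by blast
    with x(1) have "\<exists>x. x \<in> \<Union>A \<inter> \<Union>C \<and> (\<forall>B\<in>S - {A}. x \<notin> \<Union>B)" by blast
    then show ?thesis unfolding w_def by (rule someI_ex)
  qed
  have KS: "K \<subseteq> S" unfolding K_def pendants_def by blast
  have "inj_on w K"
  proof (rule inj_onI, rule ccontr)
    fix A B assume "A \<in> K" "B \<in> K" "w A = w B" "A \<noteq> B"
    then show False using w[of A] w[of B] KS by auto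
  qed
  moreover have "w ` K \<subseteq> \<Union>C" using w by blast
  ultimately have "card K \<le> card (\<Union>C)" using copy_card(4)[OF C(1)] by (metis card_inj_on_le)
  then have K: "card K \<le> card (\<Union>F)" using copy_card(3)[OF C(1)] by simp
  have "card (pendants S) \<le> card (K \<union> pendants (insert C S))"
    using finite_pendants fS KS by (intro card_mono) (auto simp: K_def finite_subset)
  also have "\<dots> \<le> card K + card (pendants (insert C S))" by (rule card_Un_le)
  \<comment> \<open>Every destroyed pendant copy costs 2, and the correction term costs at most
    1.\<close>
  finally show ?thesis using K unfolding potential_def by simp
qed

text \<open>Suppose that all copies of \<open>E\<close> meeting \<open>T\<close> lie in
  \<open>X\<close>. An edge of \<open>T\<close> closed in \<open>E\<close> then lies in the same
  copies within \<open>X\<close>, so it can fail to be closed there only through an equivalent edge.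
  That edge lies in \<open>T\<close>, because \<open>T\<close> is itself a copy, and hence is
  equivalent in \<open>E\<close> too, a contradiction.\<close>

lemma extend_copy:
  assumes cl: "copy_closed_in E T" and op: "\<not> copy_closed_in X T"
    and XE: "X \<subseteq> E" and T: "is_copy T" "T \<subseteq> X"
  shows "\<exists>C\<in>copies_in E. C \<inter> T \<noteq> {} \<and> \<not> C \<subseteq> X"
proof (rule ccontr)
  assume "\<not> ?thesis"
  then have no: "C \<in> copies_in X" if "C \<in> copies_in E" "C \<inter> T \<noteq> {}" for C
    using that unfolding copies_in_def by blast
  have mono: "C \<in> copies_in E" if "C \<in> copies_in X" for C
    using that XE unfolding copies_in_def by blast
  have "\<not> {e \<in> T. closed_in E e} \<subseteq> {e \<in> T. closed_in X e}"
  proof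
    assume "{e \<in> T. closed_in E e} \<subseteq> {e \<in> T. closed_in X e}"
    then have "card {e \<in> T. closed_in E e} \<le> card {e \<in> T. closed_in X e}"
      using copy_card(2)[OF T(1)] by (intro card_mono) auto
    then show False using cl op unfolding copy_closed_in_def by simp
  qed
  then obtain e where e: "e \<in> T" "closed_in E e" "\<not> closed_in X e" by blast
  have "{H \<in> copies_in E. e \<in> H} = {H \<in> copies_in X. e \<in> H}"
    using no mono e(1) by blast
  then obtain e' where e': "\<not> tight" "e' \<in> X - {e}" "\<forall>H\<in>copies_in X. e' \<in> H \<longleftrightarrow> e \<in> H"
    using e T unfolding closed_in_def by auto
  have "T \<in> copies_in X" using T unfolding copies_in_def by blast
  then have "e' \<in> T" using e' e by blast
  have "e' \<in> H \<longleftrightarrow> e \<in> H" if "H \<in> copies_in E" for H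
    using no[OF that] \<open>e' \<in> T\<close> e(1) e'(3) by blast
  then show False using e(2) e'(1,2) XE unfolding closed_in_def by blast
qed

section \<open>Explorations and their termination\<close>

definition extensions :: "nat \<Rightarrow> nat set set set \<Rightarrow> nat set set set" where
  "extensions n S = {C. is_copy C \<and> C \<subseteq> Pow {..<n} \<and> \<not> C \<subseteq> \<Union>S \<and> C \<inter> base S \<noteq> {}}"

definition excess :: "nat set set set \<Rightarrow> nat set set \<Rightarrow> nat" where
  "excess S C = (if card (\<Union>C \<inter> \<Union>(\<Union>S)) \<le> l then 0 else 1)"

text \<open>
  The second component counts the degenerate steps; an exploration stops once there are \<open>D\<close> of them.
\<close>

primrec states :: "nat \<Rightarrow> nat \<Rightarrow> nat \<Rightarrow> (nat set set set \<times> nat) set" where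
  "states n D 0 = (\<lambda>C. ({C}, 0)) ` {C. is_copy C \<and> C \<subseteq> Pow {..<n}}"
| "states n D (Suc i) = (\<Union>(S, d)\<in>{(S, d) \<in> states n D i. d < D}.
     (\<lambda>C. (insert C S, d + excess S C)) ` extensions n S)"

text \<open>A regular step raises the potential by at least 1, and a degenerate one lowers it by at
  most 2v+1, where v is the number of vertices of \<open>F\<close>. Charging 2v+2 for each
  degenerate step balances this against the step count.\<close>

lemma states_invariant:
  assumes "(S, d) \<in> states n D i"
  shows "finite S \<and> S \<noteq> {} \<and> card S \<le> i + 1 \<and> (\<forall>A\<in>S. is_copy A \<and> A \<subseteq> Pow {..<n}) \<and> d \<le> D \<and>
    int i - (2 * int (card (\<Union>F)) + 2) * int d \<le> potential S"
  using assms
proof (induction i arbitrary: S d)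
  case 0
  then obtain C where C: "S = {C}" "d = 0" "is_copy C" "C \<subseteq> Pow {..<n}" by auto
  have "pendants {C} = {}" unfolding pendants_def attached_def by auto
  then have "potential S = 0" unfolding potential_def C by simp
  then show ?case using C by simp
next
  case (Suc i)
  then obtain S' d' C where C: "(S', d') \<in> states n D i" "d' < D" "C \<in> extensions n S'"
    "S = insert C S'" "d = d' + excess S' C" by auto
  note IH = Suc.IH[OF C(1)]
  have C': "is_copy C" "\<not> C \<subseteq> \<Union>S'" "C \<inter> base S' \<noteq> {}" "C \<subseteq> Pow {..<n}" "C \<notin> S'"
    using C(3) unfolding extensions_def by auto
  have "int (Suc i) - (2 * int (card (\<Union>F)) + 2) * int d \<le> potential S"
  proof (cases "card (\<Union>C \<inter> \<Union>(\<Union>S')) \<le> l")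
    case True
    then have "d = d'" using C(5) unfolding excess_def by simp
    then show ?thesis using potential_regular[of S' C] IH C' True C(4) by simp
  next
    case False
    then have "d = d' + 1" using C(5) unfolding excess_def by simp
    then show ?thesis using potential_any[of S' C] IH C' C(4) by (simp add: algebra_simps)
  qed
  moreover have "d \<le> D" using C unfolding excess_def by simp
  moreover have "card S \<le> Suc i + 1" using C(4) C'(5) IH by simp
  ultimately show ?case using C(4) C' IH by simp
qed

lemma states_all_closed:
  assumes "(S, d) \<in> states n D i" "open_copies S = {}"
  shows "i \<le> (2 * card (\<Union>F) + 2) * d"
proof -
  have "int i \<le> (2 * int (card (\<Union>F)) + 2) * int d"
    using states_invariant[OF assms(1)] potential_all_closed[OF assms(2)] by linarith
  then have "int i \<le> int ((2 * card (\<Union>F) + 2) * d)" by (simp add: algebra_simps)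
  then show ?thesis by (simp only: of_nat_le_iff)
qed

text \<open>If all explored copies are closed, connectedness of the block supplies the next copy.
  Otherwise the target, closed in \<open>E\<close> but not yet in the explored part, does so by
  \<open>extend_copy\<close>.\<close>

lemma extension_exists:
  assumes E: "E \<subseteq> Pow {..<n}"
    and cl: "\<And>T. T \<in> copies_in E \<Longrightarrow> copy_closed_in E T"
    and conn: "\<And>E'. E' \<noteq> {} \<Longrightarrow> E' \<subset> E \<Longrightarrow> \<exists>H\<in>copies_in E. H \<inter> E' \<noteq> {} \<and> H - E' \<noteq> {}"
    and S: "S \<noteq> {}" "S \<subseteq> copies_in E" "\<Union>S \<noteq> E"
  shows "\<exists>C\<in>extensions n S. C \<in> copies_in E"
proof -
  have SE: "\<Union>S \<subseteq> E" using S unfolding copies_in_def by blast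
  have "\<exists>C\<in>copies_in E. C \<inter> base S \<noteq> {} \<and> \<not> C \<subseteq> \<Union>S"
  proof (cases "open_copies S = {}")
    case True
    obtain A where A: "A \<in> S" using S by blast
    then have "is_copy A" using S unfolding copies_in_def by blast
    then have "A \<noteq> {}" using copy_card(1) three_edges by fastforce
    then have "\<Union>S \<noteq> {}" using A by blast
    then show ?thesis using conn[of "\<Union>S"] SE S(3) True unfolding base_def by auto
  next
    case False
    have T: "target S \<in> S" "\<not> copy_closed_in (\<Union>S) (target S)"
      using target(1)[OF False] unfolding open_copies_def by auto
    have T': "target S \<in> copies_in E" using T S by blast
    show ?thesis
      using extend_copy[OF cl[OF T'] T(2) SE] T T' False unfolding base_def copies_in_def by auto
  qed
  then show ?thesis using E unfolding extensions_def copies_in_def by blast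
qed

text \<open>By \<open>few\<close>, no exploration inside \<open>E\<close> reaches \<open>D\<close>
  degenerate steps or \<open>N\<close> steps. As it can be continued while part of \<open>E\<close>
  is missing, some exploration exhausts \<open>E\<close>. All its copies are then closed, so
  \<open>states_all_closed\<close> bounds their number.\<close>

lemma block_exhausted:
  assumes E: "E \<subseteq> Pow {..<n}" and ne: "copies_in E \<noteq> {}"
    and cl: "\<And>T. T \<in> copies_in E \<Longrightarrow> copy_closed_in E T"
    and conn: "\<And>E'. E' \<noteq> {} \<Longrightarrow> E' \<subset> E \<Longrightarrow> \<exists>H\<in>copies_in E. H \<inter> E' \<noteq> {} \<and> H - E' \<noteq> {}"
    and few: "\<And>S d i. (S, d) \<in> states n D i \<Longrightarrow> \<Union>S \<subseteq> E \<Longrightarrow> i \<le> N \<Longrightarrow> d < D \<and> i < N"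
  shows "card (\<Union>E) \<le> card (\<Union>F) * ((2 * card (\<Union>F) + 2) * D + 1)"
proof -
  have sub: "\<Union>S \<subseteq> E" if "S \<subseteq> copies_in E" for S using that unfolding copies_in_def by blast
  have "(\<exists>S d. (S, d) \<in> states n D i \<and> S \<subseteq> copies_in E) \<or>
      (\<exists>j S d. j < i \<and> (S, d) \<in> states n D j \<and> S \<subseteq> copies_in E \<and> \<Union>S = E)" if "i \<le> N" for i
    using that
  proof (induction i)
    case 0
    obtain C where "C \<in> copies_in E" using ne by blast
    then have "({C}, 0) \<in> states n D 0" "{C} \<subseteq> copies_in E"
      using E unfolding copies_in_def by auto
    then show ?case by blast
  next
    case (Suc i)
    show ?case
    proof (cases "\<exists>j S d. j < Suc i \<and> (S, d) \<in> states n D j \<and> S \<subseteq> copies_in E \<and> \<Union>S = E")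
      case False
      then obtain S d where S: "(S, d) \<in> states n D i" "S \<subseteq> copies_in E" "\<Union>S \<noteq> E"
        using Suc by (metis Suc_leD less_Suc_eq)
      then have d: "d < D" using few[OF S(1) sub] Suc by simp
      obtain C where C: "C \<in> extensions n S" "C \<in> copies_in E"
        using extension_exists[OF E cl conn _ S(2,3)] states_invariant[OF S(1)] by blast
      have "(insert C S, d + excess S C) \<in> states n D (Suc i)"
        using S(1) d C(1) by (force simp del: Union_iff)
      moreover have "insert C S \<subseteq> copies_in E" using C S by blast
      ultimately show ?thesis by blast
    qed blast
  qed
  \<comment> \<open>For \<open>i = N\<close> the first alternative contradicts \<open>few\<close>,
    so \<open>E\<close> was exhausted earlier.\<close>
  from this[of N] obtain j S d where S: "j \<le> N" "(S, d) \<in> states n D j" "S \<subseteq> copies_in E" "\<Union>S = E"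
    using few sub by (metis le_refl less_imp_le nat_neq_iff)
  have inv: "finite S" "card S \<le> j + 1" "\<And>A. A \<in> S \<Longrightarrow> is_copy A"
    using states_invariant[OF S(2)] by auto
  have "open_copies S = {}" using cl S(3,4) unfolding open_copies_def by auto
  then have "j \<le> (2 * card (\<Union>F) + 2) * d" by (rule states_all_closed[OF S(2)])
  also have "\<dots> \<le> (2 * card (\<Union>F) + 2) * D" using few[OF S(2)] S(1,4) by (intro mult_left_mono) auto
  finally have j: "card S \<le> (2 * card (\<Union>F) + 2) * D + 1" using inv by simp
  have "card (\<Union>E) = card (\<Union>A\<in>S. \<Union>A)" using S(4) by (intro arg_cong[of _ _ card]) blast
  also have "\<dots> \<le> (\<Sum>A\<in>S. card (\<Union>A))" using inv by (intro card_UN_le)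
  also have "\<dots> = card S * card (\<Union>F)" using copy_card(3)[OF inv(3)] by simp
  also have "\<dots> \<le> ((2 * card (\<Union>F) + 2) * D + 1) * card (\<Union>F)" using j by (intro mult_right_mono) auto
  finally show ?thesis by (simp add: mult.commute)
qed

end

subsection \<open>Expected number of explorations\<close>

text \<open>The sets \<open>A i\<close> may overlap; each \<open>x\<close> is charged to one chosen
  index.\<close>

lemma sum_le_cover:
  fixes g :: "'b \<Rightarrow> real"
  assumes fin: "finite X" "finite I" "\<And>i. i \<in> I \<Longrightarrow> finite (A i)"
    and b: "\<And>i. i \<in> I \<Longrightarrow> 0 \<le> b i"
    and cover: "\<And>x. x \<in> X \<Longrightarrow> \<exists>i\<in>I. x \<in> A i \<and> g x \<le> b i"
  shows "sum g X \<le> (\<Sum>i\<in>I. real (card (A i)) * b i)"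
proof -
  obtain h where h: "\<And>x. x \<in> X \<Longrightarrow> h x \<in> I \<and> x \<in> A (h x) \<and> g x \<le> b (h x)"
    using cover by metis
  have "sum g X = (\<Sum>i\<in>I. sum g {x \<in> X. h x = i})"
    using fin h by (intro sum.group[symmetric]) auto
  also have "\<dots> \<le> (\<Sum>i\<in>I. real (card (A i)) * b i)"
  proof (rule sum_mono)
    fix i assume i: "i \<in> I"
    have "sum g {x \<in> X. h x = i} \<le> real (card {x \<in> X. h x = i}) * b i"
      using h by (intro sum_bounded_above) auto
    also have "\<dots> \<le> real (card (A i)) * b i"
      using h fin i b by (intro mult_right_mono of_nat_mono card_mono) auto
    finally show "sum g {x \<in> X. h x = i} \<le> real (card (A i)) * b i" .
  qed
  finally show ?thesis .
qed

lemma prob_all_edges_present: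
  assumes "finite A" "Y \<subseteq> A" "0 \<le> p" "p \<le> 1"
  shows "measure_pmf.prob (Pi_pmf A False (\<lambda>_. bernoulli_pmf p)) {X. \<forall>y\<in>Y. X y} = p ^ card Y"
proof -
  have "{X. \<forall>y\<in>Y. X y} = Pi A (\<lambda>y. if y \<in> Y then {True} else UNIV)"
    using assms(2) by (auto simp: Pi_def split: if_splits)
  then have "measure_pmf.prob (Pi_pmf A False (\<lambda>_. bernoulli_pmf p)) {X. \<forall>y\<in>Y. X y} =
      (\<Prod>y\<in>A. if y \<in> Y then p else 1)"
    using assms by (simp add: measure_Pi_pmf_Pi measure_pmf_single if_distrib cong: if_cong prod.cong)
  also have "\<dots> = p ^ card Y"
    using assms by (simp add: prod.If_cases Int_absorb1 Int_commute)
  finally show ?thesis .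
qed

context balanced_family
begin

section \<open>Counting extensions through maps of the vertices of \<open>F\<close>\<close>

lemma l_less: "l < card (\<Union>F)"
proof -
  have "0 < m * (real (card (\<Union>F)) - real l)" using density_F three_edges by simp
  then show ?thesis using m_pos by (simp add: zero_less_mult_iff)
qed

text \<open>Injectivity is dropped: this only overcounts, and the number of maps becomes a plain
  product. Extensional functions make that number finite.\<close>

definition image_copies :: "nat \<Rightarrow> 'a set \<Rightarrow> nat set \<Rightarrow> nat set set set" where
  "image_copies n U Q = (\<lambda>\<phi>. (`) \<phi> ` F) ` {\<phi> \<in> \<Union>F \<rightarrow>\<^sub>E {..<n}. \<phi> ` U \<subseteq> Q}"

lemma card_image_copies:
  assumes "U \<subseteq> \<Union>F" "finite Q"
  shows "finite (image_copies n U Q)"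
    "card (image_copies n U Q) \<le> card Q ^ card U * n ^ (card (\<Union>F) - card U)"
proof -
  let ?P = "PiE (\<Union>F) (\<lambda>x. if x \<in> U then Q else {..<n})"
  have sub: "{\<phi> \<in> \<Union>F \<rightarrow>\<^sub>E {..<n}. \<phi> ` U \<subseteq> Q} \<subseteq> ?P"
    by (auto simp: PiE_def Pi_def)
  have fin: "finite ?P" using finite_Union_F assms by (intro finite_PiE) auto
  then show "finite (image_copies n U Q)"
    unfolding image_copies_def using finite_subset[OF sub] by simp
  have "card (image_copies n U Q) \<le> card {\<phi> \<in> \<Union>F \<rightarrow>\<^sub>E {..<n}. \<phi> ` U \<subseteq> Q}"
    unfolding image_copies_def using finite_subset[OF sub fin] by (rule card_image_le)
  also have "\<dots> \<le> card ?P" by (rule card_mono[OF fin sub])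
  also have "\<dots> = (\<Prod>x\<in>\<Union>F. if x \<in> U then card Q else n)"
    using finite_Union_F by (subst card_PiE) (auto intro!: prod.cong)
  also have "\<dots> = card Q ^ card U * n ^ (card (\<Union>F) - card U)"
  proof -
    have "\<Union>F \<inter> {x. x \<in> U} = U" "\<Union>F \<inter> - {x. x \<in> U} = \<Union>F - U" using assms by auto
    then show ?thesis using finite_Union_F assms
      by (simp add: prod.If_cases card_Diff_subset finite_subset[OF assms(1)])
  qed
  finally show "card (image_copies n U Q) \<le> card Q ^ card U * n ^ (card (\<Union>F) - card U)" .
qed

text \<open>One embedding serves all \<open>U\<close> and \<open>Q\<close>, so that \<open>U\<close>
  may later be defined from the embedding itself.\<close>

lemma copy_image_copies:
  assumes "is_copy C" "C \<subseteq> Pow {..<n}"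
  shows "\<exists>\<phi>. inj_on \<phi> (\<Union>F) \<and> C = (`) \<phi> ` F \<and> (\<forall>U Q. U \<subseteq> \<Union>F \<longrightarrow> \<phi> ` U \<subseteq> Q \<longrightarrow> C \<in> image_copies n U Q)"
proof -
  obtain \<phi> where i: "inj_on \<phi> (\<Union>F)" and C: "C = (`) \<phi> ` F"
    using assms(1) unfolding is_copy_def by auto
  define \<psi> where "\<psi> = restrict \<phi> (\<Union>F)"
  have eq: "\<psi> ` U = \<phi> ` U" if "U \<subseteq> \<Union>F" for U
    using that unfolding \<psi>_def by (intro image_cong) auto
  have "(`) \<psi> ` F = (`) \<phi> ` F" by (rule image_cong[OF refl], rule eq, rule Union_upper)
  then have C': "C = (`) \<psi> ` F" using C by simp
  have "\<phi> ` \<Union>F = \<Union>C" using C by blast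
  then have "\<phi> ` \<Union>F \<subseteq> {..<n}" using assms(2) by blast
  then have "\<psi> \<in> \<Union>F \<rightarrow>\<^sub>E {..<n}" unfolding \<psi>_def by auto
  then have "C \<in> image_copies n U Q" if "U \<subseteq> \<Union>F" "\<phi> ` U \<subseteq> Q" for U Q
    using C' eq that unfolding image_copies_def by auto
  then show ?thesis using i C by blast
qed

lemma finite_copies_on: "finite {C. is_copy C \<and> C \<subseteq> Pow {..<n::nat}}"
  by (rule finite_subset[of _ "Pow (Pow {..<n})"]) auto

lemma card_copies_on: "card {C. is_copy C \<and> C \<subseteq> Pow {..<n::nat}} \<le> n ^ card (\<Union>F)"
proof -
  have "{C. is_copy C \<and> C \<subseteq> Pow {..<n}} \<subseteq> image_copies n {} {}"
    using copy_image_copies by blast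
  then have "card {C. is_copy C \<and> C \<subseteq> Pow {..<n}} \<le> card (image_copies n {} {})"
    using card_image_copies(1)[of "{}" "{}" n] by (intro card_mono) auto
  also have "\<dots> \<le> n ^ card (\<Union>F)" using card_image_copies(2)[of "{}" "{}" n] by simp
  finally show ?thesis .
qed

lemma finite_extensions: "finite (extensions n S)"
  by (rule finite_subset[OF _ finite_copies_on[of n]]) (auto simp: extensions_def)

lemma finite_states: "finite (states n D i)"
proof (induction i)
  case 0
  then show ?case using finite_copies_on by simp
next
  case (Suc i)
  then have "finite {(S, d) \<in> states n D i. d < D}"
    by (rule rev_finite_subset) auto
  then show ?case using finite_extensions by auto
qed

text \<open>The bound does not involve \<open>i\<close>: the base is a single copy unless all copies
  are closed, and in that case \<open>states_all_closed\<close> bounds \<open>i\<close> by a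
  multiple of \<open>d\<close>.\<close>

lemma card_base:
  assumes "(S, d) \<in> states n D i" "d < D"
  shows "card (base S) \<le> card F * ((2 * card (\<Union>F) + 2) * D + 1)" "finite (base S)"
proof -
  have inv: "finite S" "card S \<le> i + 1" "\<And>A. A \<in> S \<Longrightarrow> is_copy A"
    using states_invariant[OF assms(1)] by auto
  show "finite (base S)"
    using base_subset[of S] inv copy_card(2) by (meson finite_Union finite_subset)
  show "card (base S) \<le> card F * ((2 * card (\<Union>F) + 2) * D + 1)"
  proof (cases "open_copies S = {}")
    case True
    have "card (\<Union>S) \<le> (\<Sum>A\<in>S. card A)" by (rule card_Union_le_sum_card) 
    also have "\<dots> = card S * card F" using copy_card(1)[OF inv(3)] by simp
    also have "\<dots> \<le> (i + 1) * card F" using inv by (intro mult_right_mono) auto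
    also have "\<dots> \<le> ((2 * card (\<Union>F) + 2) * d + 1) * card F"
      using states_all_closed[OF assms(1) True] by (intro mult_right_mono) auto
    also have "\<dots> \<le> ((2 * card (\<Union>F) + 2) * D + 1) * card F"
      using assms(2) by (intro mult_right_mono add_mono mult_left_mono) auto
    finally show ?thesis using True by (simp add: base_def mult.commute)
  next
    case False
    then have "is_copy (target S)" using target(1) inv unfolding open_copies_def by blast
    then have "card (base S) = card F * 1" using copy_card(1) False by (simp add: base_def)
    also have "\<dots> \<le> card F * ((2 * card (\<Union>F) + 2) * D + 1)" by (intro mult_left_mono) auto
    finally show ?thesis .
  qed
qed

text \<open>A regular extension is described by an edge \<open>c\<close> of the base, the edge
  \<open>f\<close> of \<open>F\<close> placed on it, one of at most l^l maps from \<open>f\<close>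
  to \<open>c\<close>, and the images of the other vertices. All its edges except \<open>c\<close>
  are new.\<close>

lemma regular_weight:
  assumes fin: "finite (base S)" and p: "0 \<le> p"
  shows "(\<Sum>C\<in>{C \<in> extensions n S. excess S C = 0}. p ^ card (C - \<Union>S)) \<le>
    real (card (base S) * card F * l ^ l) * (real n ^ (card (\<Union>F) - l) * p ^ (card F - 1))"
proof -
  let ?b = "p ^ (card F - 1)"
  let ?I = "{c \<in> base S. card c = l} \<times> F"
  have uF: "f \<subseteq> \<Union>F" if "f \<in> F" for f using that by blast
  have fc: "finite c" if "card c = l" for c :: "nat set"
    using that l_pos by (metis card.infinite not_one_le_zero)
  have "(\<Sum>C\<in>{C \<in> extensions n S. excess S C = 0}. p ^ card (C - \<Union>S)) \<le>
    (\<Sum>i\<in>?I. real (card ((\<lambda>(c, f). image_copies n f c) i)) * ?b)"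
  proof (rule sum_le_cover)
    fix C assume "C \<in> {C \<in> extensions n S. excess S C = 0}"
    then have C: "is_copy C" "C \<subseteq> Pow {..<n}" "C \<inter> base S \<noteq> {}"
      "card (\<Union>C \<inter> \<Union>(\<Union>S)) \<le> l" unfolding extensions_def excess_def by (auto split: if_splits)
    then obtain c where c: "c \<in> C" "c \<in> base S" by blast
    have "attached (\<Union>S) C c" using attachedI[OF C(1) c(1) _ C(4)] c(2) base_subset by blast
    from attached_disjoint[OF this] have "C - \<Union>S = C - {c}" by blast
    then have card: "card (C - \<Union>S) = card F - 1" using c copy_card[OF C(1)] by simp
    obtain \<phi> where \<phi>: "C = (`) \<phi> ` F" "\<forall>U Q. U \<subseteq> \<Union>F \<longrightarrow> \<phi> ` U \<subseteq> Q \<longrightarrow> C \<in> image_copies n U Q"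
      using copy_image_copies[OF C(1,2)] by blast
    then obtain f where f: "f \<in> F" "c = \<phi> ` f" using c by blast
    then have "C \<in> image_copies n f c" using \<phi> uF by blast
    then show "\<exists>i\<in>?I. C \<in> (\<lambda>(c, f). image_copies n f c) i \<and> p ^ card (C - \<Union>S) \<le> ?b"
      using f c card copy_edge_card(1)[OF C(1) c(1)] by auto
  next
    fix i assume "i \<in> ?I"
    then obtain c f where "i = (c, f)" "card c = l" "f \<in> F" by auto
    then show "finite ((\<lambda>(c, f). image_copies n f c) i)"
      using card_image_copies(1)[OF uF fc] by simp
  qed (use fin finite_F finite_extensions p in simp_all)
  also have "\<dots> \<le> (\<Sum>i\<in>?I. real (l ^ l * n ^ (card (\<Union>F) - l)) * ?b)"
  proof (rule sum_mono)
    fix i assume "i \<in> ?I"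
    then obtain c f where i: "i = (c, f)" "card c = l" "f \<in> F" by auto
    have "card (image_copies n f c) \<le> l ^ l * n ^ (card (\<Union>F) - l)"
      using card_image_copies(2)[OF uF[OF i(3)] fc[OF i(2)], of n] i uniform_F by simp
    then show "real (card ((\<lambda>(c, f). image_copies n f c) i)) * ?b \<le>
        real (l ^ l * n ^ (card (\<Union>F) - l)) * ?b"
      unfolding i using p by (intro mult_right_mono of_nat_mono) auto
  qed
  also have "\<dots> = real (card {c \<in> base S. card c = l} * card F * l ^ l) * (real n ^ (card (\<Union>F) - l) * ?b)"
    by (simp add: card_cartesian_product)
  also have "\<dots> \<le> real (card (base S) * card F * l ^ l) * (real n ^ (card (\<Union>F) - l) * ?b)"
    using fin p by (intro mult_right_mono of_nat_mono mult_right_mono card_mono) auto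
  finally show ?thesis .
qed

text \<open>The possible traces of a degenerate copy: \<open>U\<close> is placed on explored
  vertices and \<open>J\<close> on explored edges. \<open>J\<close> is non-empty because the copy
  meets the base, and proper because the copy is not fully explored.\<close>

definition overlaps :: "('a set \<times> 'a set set) set" where
  "overlaps = {(U, J). U \<subseteq> \<Union>F \<and> J \<subset> F \<and> J \<noteq> {} \<and> \<Union>J \<subseteq> U \<and> l < card U}"

lemma finite_overlaps: "finite overlaps"
  by (rule finite_subset[of _ "Pow (\<Union>F) \<times> Pow F"])
    (use finite_F finite_Union_F in \<open>auto simp: overlaps_def\<close>)

text \<open>For two or more edges, strict balancedness of \<open>J\<close> gives a strict
  inequality; for a single edge, \<open>l < card U\<close> does. Subtracting from
  \<open>density_F\<close> yields a positive gain for every trace, and finiteness makes it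
  uniform.\<close>

lemma overlap_gain:
  "\<exists>\<alpha>>0. \<forall>(U, J)\<in>overlaps. real (card (\<Union>F) - card U) + \<alpha> \<le> real (card F - card J) / m"
proof -
  define g where "g = (\<lambda>(U :: 'a set, J :: 'a set set). real (card F - card J) / m - real (card (\<Union>F) - card U))"
  have pos: "0 < g x" if x: "x \<in> overlaps" for x
  proof -
    obtain U J where UJ: "x = (U, J)" "U \<subseteq> \<Union>F" "J \<subset> F" "J \<noteq> {}" "\<Union>J \<subseteq> U" "l < card U"
      using x unfolding overlaps_def by auto
    have fJ: "finite J" and fU: "finite U"
      using UJ finite_F finite_Union_F by (auto intro: finite_subset)
    have "card (\<Union>J) \<le> card U" using UJ fU by (simp add: card_mono)
    have "real (card J) - 1 < m * (real (card U) - real l)"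
    proof (cases "2 \<le> card J")
      case True
      have "real (card J) - 1 < m * (real (card (\<Union>J)) - real l)" by (rule strictly[OF UJ(3) True])
      also have "\<dots> \<le> m * (real (card U) - real l)" using \<open>card (\<Union>J) \<le> card U\<close> m_pos by simp
      finally show ?thesis .
    next
      case False
      then have "real (card J) - 1 \<le> 0" by simp
      also have "0 < m * (real (card U) - real l)" using m_pos UJ by simp
      finally show ?thesis .
    qed
    then have "m * (real (card (\<Union>F)) - real (card U)) < real (card F) - real (card J)"
      using density_F by (simp add: algebra_simps)
    then have "real (card (\<Union>F)) - real (card U) < (real (card F) - real (card J)) / m"
      using m_pos by (simp add: pos_less_divide_eq mult.commute)
    moreover have "card U \<le> card (\<Union>F)" "card J \<le> card F"
      using UJ finite_F finite_Union_F by (auto intro: card_mono)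
    ultimately show ?thesis using UJ(1) unfolding g_def by (simp add: of_nat_diff)
  qed
  \<comment> \<open>The inserted 1 keeps the minimum meaningful if there are no overlaps.\<close>
  define \<alpha> where "\<alpha> = Min (insert 1 (g ` overlaps))"
  have "0 < \<alpha>" unfolding \<alpha>_def using pos finite_overlaps by (subst Min_gr_iff) auto
  moreover have "\<alpha> \<le> g x" if "x \<in> overlaps" for x
    unfolding \<alpha>_def using that finite_overlaps by (intro Min_le) auto
  then have "real (card (\<Union>F) - card U) + \<alpha> \<le> real (card F - card J) / m"
    if "(U, J) \<in> overlaps" for U J
    using that unfolding g_def by fastforce
  ultimately show ?thesis by blast
qed

text \<open>Every vertex of \<open>U\<close> has at most \<open>w\<close> images and every other
  vertex at most \<open>n\<close>. As \<open>1 \<le> w\<close>, the exponent of \<open>w\<close> can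
  be raised to the number of vertices of \<open>F\<close>.\<close>

lemma degenerate_weight:
  assumes S: "finite (\<Union>(\<Union>S))" "card (\<Union>(\<Union>S)) \<le> w" "1 \<le> w" and p: "0 \<le> p"
    and B: "\<And>U J. (U, J) \<in> overlaps \<Longrightarrow> real n ^ (card (\<Union>F) - card U) * p ^ (card F - card J) \<le> B"
    and B0: "0 \<le> B"
  shows "(\<Sum>C\<in>{C \<in> extensions n S. excess S C = 1}. p ^ card (C - \<Union>S)) \<le>
    real (card overlaps) * real w ^ card (\<Union>F) * B"
proof -
  let ?Q = "\<Union>(\<Union>S)"
  have "(\<Sum>C\<in>{C \<in> extensions n S. excess S C = 1}. p ^ card (C - \<Union>S)) \<le>
    (\<Sum>i\<in>overlaps. real (card (image_copies n (fst i) ?Q)) * p ^ (card F - card (snd i)))"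
  proof (rule sum_le_cover)
    fix C assume "C \<in> {C \<in> extensions n S. excess S C = 1}"
    then have C: "is_copy C" "C \<subseteq> Pow {..<n}" "C \<inter> base S \<noteq> {}" "\<not> C \<subseteq> \<Union>S"
      "l < card (\<Union>C \<inter> ?Q)" unfolding extensions_def excess_def by (auto split: if_splits)
    obtain \<phi> where \<phi>: "inj_on \<phi> (\<Union>F)" "C = (`) \<phi> ` F"
      "\<And>U Q. U \<subseteq> \<Union>F \<Longrightarrow> \<phi> ` U \<subseteq> Q \<Longrightarrow> C \<in> image_copies n U Q"
      using copy_image_copies[OF C(1,2)] by blast
    define U where "U = {x \<in> \<Union>F. \<phi> x \<in> ?Q}"
    define J where "J = {f \<in> F. \<phi> ` f \<in> \<Union>S}"
    have UU: "\<phi> ` U = \<Union>C \<inter> ?Q" using \<phi>(2) unfolding U_def by blast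
    moreover have "U \<subseteq> \<Union>F" unfolding U_def by blast
    ultimately have "card U = card (\<Union>C \<inter> ?Q)"
      using card_image[OF inj_on_subset[OF \<phi>(1), of U]] by simp
    then have U: "l < card U" "C \<in> image_copies n U ?Q" using C(5) \<phi>(3)[of U ?Q] UU unfolding U_def by auto
    have "C \<inter> \<Union>S \<noteq> {}" using C(3) base_subset by blast
    then have J: "J \<noteq> {}" "J \<subset> F" using C(4) \<phi>(2) unfolding J_def by auto
    have "\<Union>J \<subseteq> U" unfolding J_def U_def by blast
    then have ov: "(U, J) \<in> overlaps" using U J unfolding overlaps_def U_def by auto
    have "C - \<Union>S = (`) \<phi> ` (F - J)" using \<phi>(2) unfolding J_def by blast
    moreover have "inj_on ((`) \<phi>) (F - J)"
      by (intro inj_on_image inj_on_subset[OF \<phi>(1)]) blast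
    ultimately have "card (C - \<Union>S) = card (F - J)" by (simp add: card_image)
    also have "\<dots> = card F - card J"
      using J finite_F by (intro card_Diff_subset) (auto intro: finite_subset)
    finally show "\<exists>i\<in>overlaps. C \<in> image_copies n (fst i) ?Q \<and>
        p ^ card (C - \<Union>S) \<le> p ^ (card F - card (snd i))"
      using ov U by (intro bexI[of _ "(U, J)"]) auto
  next
    show "finite (image_copies n (fst i) ?Q)" if "i \<in> overlaps" for i
      using that S(1) by (intro card_image_copies(1)) (auto simp: overlaps_def)
  qed (use finite_overlaps finite_extensions p in auto)
  also have "\<dots> \<le> (\<Sum>i\<in>overlaps. real w ^ card (\<Union>F) * B)"
  proof (rule sum_mono)
    fix i assume i: "i \<in> overlaps"
    obtain U J where UJ: "i = (U, J)" by (cases i)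
    have U: "U \<subseteq> \<Union>F" using i UJ unfolding overlaps_def by auto
    have "card (image_copies n U ?Q) \<le> card ?Q ^ card U * n ^ (card (\<Union>F) - card U)"
      by (rule card_image_copies(2)[OF U S(1)])
    also have "\<dots> \<le> w ^ card (\<Union>F) * n ^ (card (\<Union>F) - card U)"
    proof (intro mult_right_mono)
      have "card ?Q ^ card U \<le> w ^ card U" using S by (intro power_mono) auto
      also have "\<dots> \<le> w ^ card (\<Union>F)"
        using S U finite_Union_F by (intro power_increasing card_mono) auto
      finally show "card ?Q ^ card U \<le> w ^ card (\<Union>F)" .
    qed simp
    finally have "real (card (image_copies n U ?Q)) \<le> real (w ^ card (\<Union>F) * n ^ (card (\<Union>F) - card U))"
      by (rule of_nat_mono)
    then have "real (card (image_copies n U ?Q)) * p ^ (card F - card J) \<le>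
        real (w ^ card (\<Union>F) * n ^ (card (\<Union>F) - card U)) * p ^ (card F - card J)"
      using p by (intro mult_right_mono) auto
    also have "\<dots> = real w ^ card (\<Union>F) * (real n ^ (card (\<Union>F) - card U) * p ^ (card F - card J))"
      by simp
    also have "\<dots> \<le> real w ^ card (\<Union>F) * B" using B[of U J] i UJ by (intro mult_left_mono) auto
    finally show "real (card (image_copies n (fst i) ?Q)) * p ^ (card F - card (snd i)) \<le>
        real w ^ card (\<Union>F) * B" using UJ by simp
  qed
  also have "\<dots> = real (card overlaps) * real w ^ card (\<Union>F) * B" by simp
  finally show ?thesis .
qed

text \<open>
  The factor \<open>t ^ d\<close>, with \<open>t\<close> a power of \<open>n\<close>, compensates for the cost of degenerate steps, so that the
  total weight halves in every step.
\<close>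

definition weight :: "nat \<Rightarrow> nat \<Rightarrow> real \<Rightarrow> real \<Rightarrow> nat \<Rightarrow> real" where
  "weight n D p t i = (\<Sum>(S, d)\<in>states n D i. p ^ card (\<Union>S) * t ^ d)"

lemma finite_Union_state: "(S, d) \<in> states n D i \<Longrightarrow> finite (\<Union>S)"
  using states_invariant[of S d n D i] copy_card(2) by (meson finite_Union)

lemma weight_0:
  assumes "0 \<le> p" "p \<le> 1"
  shows "weight n D p t 0 \<le> real n ^ card (\<Union>F)"
proof -
  let ?K = "{C. is_copy C \<and> C \<subseteq> Pow {..<n}}"
  have "weight n D p t 0 = (\<Sum>C\<in>?K. p ^ card C)"
    unfolding weight_def by (simp add: sum.reindex inj_on_def)
  also have "\<dots> \<le> real (card ?K) * 1"
    using assms by (intro sum_bounded_above) (auto simp: power_le_one)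
  also have "\<dots> \<le> real (n ^ card (\<Union>F))" using card_copies_on by (simp only: mult_1_right of_nat_mono)
  finally show ?thesis by simp
qed

lemma weight_Suc:
  assumes p: "0 \<le> p" and t: "0 \<le> t"
    and half: "\<And>S d. (S, d) \<in> states n D i \<Longrightarrow> d < D \<Longrightarrow>
      (\<Sum>C\<in>extensions n S. p ^ card (C - \<Union>S) * t ^ excess S C) \<le> 1 / 2"
  shows "weight n D p t (Suc i) \<le> weight n D p t i / 2"
proof -
  let ?P = "{(S, d) \<in> states n D i. d < D}"
  let ?g = "\<lambda>(S, d). p ^ card (\<Union>S) * t ^ d"
  let ?h = "\<lambda>((S, d), C). (insert C S, d + excess S C)"
  let ?X = "Sigma ?P (\<lambda>(S, d). extensions n S)"
  have fP: "finite ?P" by (rule finite_subset[OF _ finite_states[of n D i]]) auto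
  have fX: "finite ?X" using fP finite_extensions by (intro finite_SigmaI) auto
  have "states n D (Suc i) = ?h ` ?X" by force
  then have "weight n D p t (Suc i) = sum ?g (?h ` ?X)" unfolding weight_def by simp
  \<comment> \<open>Several explorations may lead to the same state, so \<open>?h\<close> need not
    be injective; nonnegative terms suffice.\<close>
  also have "\<dots> \<le> sum (?g \<circ> ?h) ?X"
    using fX p t by (intro sum_image_le) (auto split: prod.splits)
  also have "\<dots> = (\<Sum>x\<in>?P. \<Sum>C\<in>(\<lambda>(S, d). extensions n S) x. ?g (?h (x, C)))"
    using sum.Sigma[OF fP, of "\<lambda>(S, d). extensions n S" "\<lambda>x C. ?g (?h (x, C))"] finite_extensions
    by (simp add: o_def case_prod_unfold)
  also have "\<dots> \<le> (\<Sum>x\<in>?P. ?g x / 2)"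
  proof (rule sum_mono)
    fix x assume x: "x \<in> ?P"
    obtain S d where S: "x = (S, d)" "(S, d) \<in> states n D i" "d < D" using x by auto
    have "(\<Sum>C\<in>extensions n S. ?g (?h (x, C))) =
      (\<Sum>C\<in>extensions n S. p ^ card (\<Union>S) * t ^ d * (p ^ card (C - \<Union>S) * t ^ excess S C))"
    proof (rule sum.cong[OF refl])
      fix C assume "C \<in> extensions n S"
      then have "finite C" using copy_card(2) unfolding extensions_def by blast
      have "\<Union>(insert C S) = \<Union>S \<union> (C - \<Union>S)" by blast
      then have "card (\<Union>(insert C S)) = card (\<Union>S) + card (C - \<Union>S)"
        using finite_Union_state[OF S(2)] \<open>finite C\<close>
        by (metis Diff_disjoint card_Un_disjoint finite_Diff)
      then show "?g (?h (x, C)) = p ^ card (\<Union>S) * t ^ d * (p ^ card (C - \<Union>S) * t ^ excess S C)"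
        unfolding S(1) by (simp add: power_add)
    qed
    also have "\<dots> = p ^ card (\<Union>S) * t ^ d * (\<Sum>C\<in>extensions n S. p ^ card (C - \<Union>S) * t ^ excess S C)"
      by (simp add: sum_distrib_left)
    also have "\<dots> \<le> p ^ card (\<Union>S) * t ^ d * (1 / 2)"
      using half[OF S(2,3)] p t by (intro mult_left_mono) auto
    finally show "(\<Sum>C\<in>(\<lambda>(S, d). extensions n S) x. ?g (?h (x, C))) \<le> ?g x / 2"
      unfolding S(1) by simp
  qed
  also have "\<dots> \<le> (\<Sum>x\<in>states n D i. ?g x / 2)"
    using finite_states p t by (intro sum_mono2) auto
  also have "\<dots> = weight n D p t i / 2" unfolding weight_def by (simp add: sum_divide_distrib)
  finally show ?thesis .
qed

lemma weight_le:
  assumes p: "0 \<le> p" "p \<le> 1" and t: "0 \<le> t"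
    and half: "\<And>S d i. (S, d) \<in> states n D i \<Longrightarrow> d < D \<Longrightarrow> i < N \<Longrightarrow>
      (\<Sum>C\<in>extensions n S. p ^ card (C - \<Union>S) * t ^ excess S C) \<le> 1 / 2"
    and i: "i \<le> N"
  shows "weight n D p t i \<le> real n ^ card (\<Union>F) * (1 / 2) ^ i"
  using i
proof (induction i)
  case 0
  then show ?case using weight_0[OF p] by simp
next
  case (Suc i)
  have "weight n D p t (Suc i) \<le> weight n D p t i / 2"
    using half Suc.prems by (intro weight_Suc[OF p(1) t]) auto
  then show ?case using Suc by simp
qed

section \<open>Union bound over long or highly degenerate explorations\<close>

definition possible_edges :: "nat \<Rightarrow> nat set set" where
  "possible_edges n = {e. e \<subseteq> {..<n} \<and> card e = l}"

text \<open>Outside this event, hypothesis \<open>few\<close> of \<open>block_exhausted\<close>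
  holds for every edge set present in the random graph.\<close>

definition exceptional :: "nat \<Rightarrow> nat \<Rightarrow> nat \<Rightarrow> (nat set \<Rightarrow> bool) set" where
  "exceptional n D N =
    {X. \<exists>i\<le>N. \<exists>(S, d)\<in>states n D i. (d = D \<or> i = N) \<and> (\<forall>e\<in>\<Union>S. X e)}"

lemma finite_possible_edges: "finite (possible_edges n)"
  by (rule finite_subset[of _ "Pow {..<n}"]) (auto simp: possible_edges_def)

lemma prob_state:
  assumes "(S, d) \<in> states n D i" "0 \<le> p" "p \<le> 1"
  shows "measure_pmf.prob (Pi_pmf (possible_edges n) False (\<lambda>_. bernoulli_pmf p))
    {X. \<forall>e\<in>\<Union>S. X e} = p ^ card (\<Union>S)"
proof -
  have "\<And>A. A \<in> S \<Longrightarrow> is_copy A \<and> A \<subseteq> Pow {..<n}" using states_invariant[OF assms(1)] by blast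
  then have "\<Union>S \<subseteq> possible_edges n"
    using copy_edge_card(1) unfolding possible_edges_def by blast
  then show ?thesis using assms by (intro prob_all_edges_present finite_possible_edges)
qed

text \<open>A state is present with probability equal to its weight divided by \<open>t ^ d\<close>.
  With \<open>D\<close> degenerate steps this saves \<open>t ^ D\<close>, and the halving weights
  sum to a geometric series, whence the factor 2. After \<open>N\<close> steps the weight itself is
  small, and \<open>1 \<le> t\<close>.\<close>

lemma prob_exceptional:
  assumes p: "0 \<le> p" "p \<le> 1" and t: "1 \<le> t"
    and half: "\<And>S d i. (S, d) \<in> states n D i \<Longrightarrow> d < D \<Longrightarrow> i < N \<Longrightarrow>
      (\<Sum>C\<in>extensions n S. p ^ card (C - \<Union>S) * t ^ excess S C) \<le> 1 / 2"
  shows "measure_pmf.prob (Pi_pmf (possible_edges n) False (\<lambda>_. bernoulli_pmf p)) (exceptional n D N) \<le>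
    real n ^ card (\<Union>F) * (2 * (1 / t) ^ D + (1 / 2) ^ N)"
proof -
  let ?pr = "measure_pmf.prob (Pi_pmf (possible_edges n) False (\<lambda>_. bernoulli_pmf p))"
  let ?E = "\<lambda>(S, d::nat). {X. \<forall>e\<in>\<Union>S. X e} :: (nat set \<Rightarrow> bool) set"
  let ?g = "\<lambda>(S, d). p ^ card (\<Union>S) * t ^ d"
  let ?w = "weight n D p t"
  let ?v = "card (\<Union>F)"
  have W: "?w i \<le> real n ^ ?v * (1 / 2) ^ i" if "i \<le> N" for i
    using weight_le[OF p _ half that] t by simp
  have g0: "0 \<le> ?g x" for x using p t by (simp add: case_prod_unfold)
  have "exceptional n D N \<subseteq> (\<Union>i\<le>N. \<Union>x\<in>{x \<in> states n D i. snd x = D}. ?E x) \<union> (\<Union>x\<in>states n D N. ?E x)"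
    unfolding exceptional_def by fastforce
  then have "?pr (exceptional n D N) \<le>
      ?pr ((\<Union>i\<le>N. \<Union>x\<in>{x \<in> states n D i. snd x = D}. ?E x) \<union> (\<Union>x\<in>states n D N. ?E x))"
    by (intro measure_pmf.finite_measure_mono) auto
  also have "\<dots> \<le> ?pr (\<Union>i\<le>N. \<Union>x\<in>{x \<in> states n D i. snd x = D}. ?E x) + ?pr (\<Union>x\<in>states n D N. ?E x)"
    by (intro measure_Un_le) auto
  also have "?pr (\<Union>x\<in>states n D N. ?E x) \<le> ?w N"
  proof -
    have "?pr (\<Union>x\<in>states n D N. ?E x) \<le> (\<Sum>x\<in>states n D N. ?pr (?E x))"
      using finite_states by (intro measure_pmf.finite_measure_subadditive_finite) auto
    also have "\<dots> \<le> (\<Sum>x\<in>states n D N. ?g x)"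
    proof (rule sum_mono)
      fix x assume "x \<in> states n D N"
      moreover obtain S d where "x = (S, d)" by (cases x)
      ultimately have "?pr (?E x) = p ^ card (\<Union>S) * 1" "?g x = p ^ card (\<Union>S) * t ^ d"
        using prob_state p by auto
      moreover have "p ^ card (\<Union>S) * 1 \<le> p ^ card (\<Union>S) * t ^ d"
        using t p by (intro mult_left_mono one_le_power) auto
      ultimately show "?pr (?E x) \<le> ?g x" by (simp only:)
    qed
    finally show ?thesis unfolding weight_def .
  qed
  also have "\<dots> \<le> real n ^ ?v * (1 / 2) ^ N" by (rule W) simp
  also have "?pr (\<Union>i\<le>N. \<Union>x\<in>{x \<in> states n D i. snd x = D}. ?E x) \<le>
      (\<Sum>i\<le>N. (1 / t) ^ D * (real n ^ ?v * (1 / 2) ^ i))"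
  proof (rule order_trans[OF measure_pmf.finite_measure_subadditive_finite], simp, simp, rule sum_mono)
    fix i assume "i \<in> {..N}"
    let ?P = "{x \<in> states n D i. snd x = D}"
    have "?pr (\<Union>x\<in>?P. ?E x) \<le> (\<Sum>x\<in>?P. ?pr (?E x))"
      using finite_states by (intro measure_pmf.finite_measure_subadditive_finite) auto
    also have "\<dots> = (\<Sum>x\<in>?P. (1 / t) ^ D * ?g x)"
    proof (rule sum.cong[OF refl])
      fix x assume x: "x \<in> ?P"
      then obtain S where S: "x = (S, D)" by (cases x) auto
      then have "?pr (?E x) = p ^ card (\<Union>S)" using prob_state p x by auto
      also have "\<dots> = (1 / t) ^ D * ?g x" using S t by (simp add: power_one_over)
      finally show "?pr (?E x) = (1 / t) ^ D * ?g x" .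
    qed
    also have "\<dots> \<le> (\<Sum>x\<in>states n D i. (1 / t) ^ D * ?g x)"
      using g0 t finite_states by (intro sum_mono2 mult_nonneg_nonneg) auto
    also have "\<dots> = (1 / t) ^ D * ?w i" unfolding weight_def by (simp add: sum_distrib_left)
    also have "\<dots> \<le> (1 / t) ^ D * (real n ^ ?v * (1 / 2) ^ i)"
      using W[of i] \<open>i \<in> {..N}\<close> t by (intro mult_left_mono) auto
    finally show "?pr (\<Union>x\<in>?P. ?E x) \<le> (1 / t) ^ D * (real n ^ ?v * (1 / 2) ^ i)" .
  qed
  also have "\<dots> = (1 / t) ^ D * real n ^ ?v * (\<Sum>i\<le>N. (1 / 2) ^ i)"
    by (simp add: sum_distrib_left mult.assoc)
  also have "\<dots> \<le> (1 / t) ^ D * real n ^ ?v * 2"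
    using t by (intro mult_left_mono) (simp_all add: sum_gp0)
  finally show ?thesis by (simp add: algebra_simps)
qed

lemma power_le_threshold:
  assumes "1 \<le> n" "0 \<le> p" "p \<le> c * real n powr (- 1 / m)" "0 \<le> c"
  shows "p ^ k \<le> c ^ k * real n powr (- (real k / m))"
proof -
  have "p ^ k \<le> (c * real n powr (- 1 / m)) ^ k" using assms by (intro power_mono) auto
  also have "\<dots> = c ^ k * real n powr (- (real k / m))"
    using assms by (simp add: power_mult_distrib powr_power)
  finally show ?thesis .
qed

text \<open>Regular extensions contribute at most 1/4 by the choice of \<open>c\<close>. Degenerate
  ones have total at most \<open>q\<close>, which the compensating factor \<open>1 / (4 * q)\<close>
  turns into 1/4.\<close>

lemma step_weight:
  assumes n: "1 \<le> n" and p: "0 \<le> p" "p \<le> c * real n powr (- 1 / m)" and c: "0 < c" "c \<le> 1"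
    and cM: "real (card F * ((2 * card (\<Union>F) + 2) * D + 1) * card F * l ^ l) * c \<le> 1 / 4"
    and al: "\<forall>(U, J)\<in>overlaps. real (card (\<Union>F) - card U) + \<alpha> \<le> real (card F - card J) / m"
    and q: "real (card overlaps) * real (card (\<Union>F) * N) ^ card (\<Union>F) * real n powr (- \<alpha>) \<le> q" "0 < q"
    and S: "(S, d) \<in> states n D i" "d < D" "i < N"
  shows "(\<Sum>C\<in>extensions n S. p ^ card (C - \<Union>S) * (1 / (4 * q)) ^ excess S C) \<le> 1 / 2"
proof -
  let ?v = "card (\<Union>F)" and ?X0 = "{C \<in> extensions n S. excess S C = 0}"
    and ?X1 = "{C \<in> extensions n S. excess S C = 1}"
  let ?f = "\<lambda>C. p ^ card (C - \<Union>S) * (1 / (4 * q)) ^ excess S C"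
  have "extensions n S = ?X0 \<union> ?X1" unfolding excess_def by auto
  then have "sum ?f (extensions n S) = sum ?f (?X0 \<union> ?X1)" by simp
  also have "\<dots> = sum ?f ?X0 + sum ?f ?X1"
    using finite_extensions by (intro sum.union_disjoint) auto
  also have "sum ?f ?X0 = (\<Sum>C\<in>?X0. p ^ card (C - \<Union>S))" by (intro sum.cong) auto
  also have "\<dots> \<le> 1 / 4"
  proof -
    have e1: "1 \<le> card F - 1" using three_edges by simp
    \<comment> \<open>At the threshold the powers of \<open>n\<close> for a regular step therefore
      cancel, leaving only the factor \<open>c\<close>.\<close>
    have ml: "real (card F - 1) / m = real (?v - l)"
      using density_F l_less m_pos three_edges by (simp add: of_nat_diff field_simps)
    have "p ^ (card F - 1) \<le> c ^ (card F - 1) * real n powr (- (real (card F - 1) / m))"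
      using n p c by (intro power_le_threshold) auto
    also have "\<dots> \<le> c * real n powr (- (real (card F - 1) / m))"
      using power_decreasing[OF e1, of c] c by (intro mult_right_mono) auto
    finally have "real n ^ (?v - l) * p ^ (card F - 1) \<le>
        real n powr real (?v - l) * (c * real n powr (- (real (card F - 1) / m)))"
      using n by (simp add: powr_realpow)
    also have "\<dots> = c" unfolding ml using n by (simp add: powr_minus field_simps)
    finally have b: "real n ^ (?v - l) * p ^ (card F - 1) \<le> c" .
    have "(\<Sum>C\<in>?X0. p ^ card (C - \<Union>S)) \<le>
        real (card (base S) * card F * l ^ l) * (real n ^ (?v - l) * p ^ (card F - 1))"
      by (rule regular_weight[OF card_base(2)[OF S(1,2)] p(1)])
    also have "\<dots> \<le> real (card (base S) * card F * l ^ l) * c" using b by (intro mult_left_mono) auto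
    also have "\<dots> \<le> real (card F * ((2 * ?v + 2) * D + 1) * card F * l ^ l) * c"
      using card_base(1)[OF S(1,2)] c by (intro mult_right_mono of_nat_mono) auto
    finally show ?thesis using cM by simp
  qed
  also have "sum ?f ?X1 = (\<Sum>C\<in>?X1. p ^ card (C - \<Union>S)) / (4 * q)"
    unfolding sum_divide_distrib by (intro sum.cong) auto
  also have "\<dots> \<le> 1 / 4"
  proof -
    have inv: "finite S" "card S \<le> i + 1" "\<And>A. A \<in> S \<Longrightarrow> is_copy A"
      using states_invariant[OF S(1)] by auto
    have UU: "\<Union>(\<Union>S) = (\<Union>A\<in>S. \<Union>A)" by blast
    have fin: "finite (\<Union>(\<Union>S))" unfolding UU using inv copy_card(4) by blast
    have "card (\<Union>(\<Union>S)) \<le> (\<Sum>A\<in>S. card (\<Union>A))" unfolding UU using inv by (intro card_UN_le)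
    also have "\<dots> = card S * ?v" using copy_card(3)[OF inv(3)] by simp
    also have "\<dots> \<le> N * ?v" using inv S by (intro mult_right_mono) auto
    finally have w: "card (\<Union>(\<Union>S)) \<le> ?v * N" by (simp add: mult.commute)
    have "1 \<le> ?v * N" using l_less S by (simp add: Suc_leI)
    then have "(\<Sum>C\<in>?X1. p ^ card (C - \<Union>S)) \<le>
        real (card overlaps) * real (?v * N) ^ ?v * real n powr (- \<alpha>)"
    proof (rule degenerate_weight[OF fin w _ p(1)])
      fix U J assume UJ: "(U, J) \<in> overlaps"
      have "p ^ (card F - card J) \<le> c ^ (card F - card J) * real n powr (- (real (card F - card J) / m))"
        using n p c by (intro power_le_threshold) auto
      also have "\<dots> \<le> 1 * real n powr (- (real (card F - card J) / m))"
        using c by (intro mult_right_mono power_le_one) auto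
      finally have "real n ^ (?v - card U) * p ^ (card F - card J) \<le>
          real n powr real (?v - card U) * real n powr (- (real (card F - card J) / m))"
        using n by (simp add: powr_realpow)
      also have "\<dots> = real n powr (real (?v - card U) - real (card F - card J) / m)"
        by (simp add: powr_add[symmetric])
      also have "\<dots> \<le> real n powr (- \<alpha>)" using al UJ n by (intro powr_mono) auto
      finally show "real n ^ (?v - card U) * p ^ (card F - card J) \<le> real n powr (- \<alpha>)" .
    qed simp
    then have "(\<Sum>C\<in>?X1. p ^ card (C - \<Union>S)) \<le> q" using q by linarith
    then show ?thesis using q(2) by (simp add: field_simps)
  qed
  finally show ?thesis by simp
qed

section \<open>Choice of the constants and the limit\<close>

definition critical :: "nat set set \<Rightarrow> bool" where
  "critical E \<longleftrightarrow> copies_in E \<noteq> {} \<and> (\<forall>T\<in>copies_in E. copy_closed_in E T) \<and>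
    (\<forall>E'. E' \<noteq> {} \<and> E' \<subset> E \<longrightarrow> (\<exists>H\<in>copies_in E. H \<inter> E' \<noteq> {} \<and> H - E' \<noteq> {}))"

lemma critical_bounded:
  assumes "critical E" "E \<subseteq> {e \<in> possible_edges n. X e}" "X \<notin> exceptional n D N"
  shows "card (\<Union>E) \<le> card (\<Union>F) * ((2 * card (\<Union>F) + 2) * D + 1)"
proof (rule block_exhausted)
  show "E \<subseteq> Pow {..<n}" using assms(2) unfolding possible_edges_def by blast
  fix S d i assume S: "(S, d) \<in> states n D i" "\<Union>S \<subseteq> E" "i \<le> N"
  have "\<forall>e\<in>\<Union>S. X e" using S(2) assms(2) by blast
  then have "\<not> (d = D \<or> i = N)" using assms(3) S unfolding exceptional_def by blast
  then show "d < D \<and> i < N" using states_invariant[OF S(1)] S(3) by auto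
qed (use assms(1) in \<open>auto simp: critical_def\<close>)

theorem critical_bounded_whp:
  "\<exists>c>0. \<exists>L. \<forall>p. (\<forall>n. 0 \<le> p n \<and> p n \<le> 1) \<and> (\<forall>n\<ge>1. p n \<le> c * real n powr (- 1 / m)) \<longrightarrow>
    (\<lambda>n. measure_pmf.prob (Pi_pmf (possible_edges n) False (\<lambda>_. bernoulli_pmf (p n)))
      {X. \<exists>E. critical E \<and> E \<subseteq> {e \<in> possible_edges n. X e} \<and> L < card (\<Union>E)}) \<longlonglongrightarrow> 0"
proof -
  obtain \<alpha> where al: "0 < \<alpha>"
    "\<forall>(U, J)\<in>overlaps. real (card (\<Union>F) - card U) + \<alpha> \<le> real (card F - card J) / m"
    using overlap_gain by blast
  define v where "v = card (\<Union>F)"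
  have v: "1 \<le> v" using l_less unfolding v_def by simp
  \<comment> \<open>With about n^\<beta> steps, the factor in \<open>degenerate_weight\<close> for
    choosing explored vertices is of order n^(\<alpha>/2), half of the gain.\<close>
  define \<beta> where "\<beta> = \<alpha> / (2 * real v)"
  have b: "0 < \<beta>" "real v * \<beta> = \<alpha> / 2" using al v unfolding \<beta>_def by auto
  \<comment> \<open>The compensating factor is of order n^(\<alpha>/2); its \<open>D\<close>-th
    power has to beat the n^v possible first copies.\<close>
  define D where "D = nat \<lceil>2 * real v / \<alpha>\<rceil> + 1"
  have "2 * real v / \<alpha> < real D" unfolding D_def by linarith
  then have D: "real v < \<alpha> / 2 * real D" using al by (simp add: field_simps)
  \<comment> \<open>The constant in \<open>regular_weight\<close>, with \<open>card_base\<close>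
    inserted; \<open>c\<close> is chosen against it.\<close>
  define M where "M = real (card F * ((2 * v + 2) * D + 1) * card F * l ^ l)"
  have M: "0 < M" 
  proof -
    have "0 < card F * ((2 * v + 2) * D + 1) * card F * l ^ l" using three_edges l_pos by auto
    then show ?thesis unfolding M_def by (simp only: of_nat_0_less_iff)
  qed
  define c where "c = min 1 (1 / (4 * M))"
  have c: "0 < c" "c \<le> 1" "M * c \<le> 1 / 4" using M unfolding c_def by (auto simp: min_def field_simps)
  \<comment> \<open>The 2 absorbs the rounding in \<open>N\<close>, and the added 1 makes
    \<open>A\<close> positive even if there are no overlaps.\<close>
  define A where "A = (real (card overlaps) + 1) * (2 * real v) ^ v"
  have A: "0 < A" unfolding A_def using v by simp
  define q where "q n = A * real n powr (- (\<alpha> / 2))" for n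
  define N where "N n = nat \<lceil>real n powr \<beta>\<rceil>" for n
  define u where "u n = 2 * (4 * A) ^ D * real n powr (real v - \<alpha> / 2 * real D) +
      real n powr real v * (1 / 2) powr (real n powr \<beta>)" for n
  have u: "u \<longlonglongrightarrow> 0"
  proof -
    have "(\<lambda>n. 2 * (4 * A) ^ D * real n powr (real v - \<alpha> / 2 * real D)) \<longlonglongrightarrow> 0" using D by real_asymp
    moreover have "(\<lambda>n. real n powr real v * (1 / 2) powr (real n powr \<beta>)) \<longlonglongrightarrow> 0" using b(1) by real_asymp
    ultimately show ?thesis unfolding u_def using tendsto_add by fastforce
  qed
  have "0 < \<alpha> / 2" using al by simp
  then have "\<forall>\<^sub>F n in sequentially. 4 * A * real n powr (- (\<alpha> / 2)) \<le> 1" using A by real_asymp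
  then have q1: "\<forall>\<^sub>F n in sequentially. 4 * q n \<le> 1" unfolding q_def by (simp add: mult.assoc)
  define L where "L = card (\<Union>F) * ((2 * card (\<Union>F) + 2) * D + 1)"
  have lim: "(\<lambda>n. measure_pmf.prob (Pi_pmf (possible_edges n) False (\<lambda>_. bernoulli_pmf (p n)))
      {X. \<exists>E. critical E \<and> E \<subseteq> {e \<in> possible_edges n. X e} \<and> L < card (\<Union>E)}) \<longlonglongrightarrow> 0"
    if p: "\<forall>n. 0 \<le> p n \<and> p n \<le> 1" "\<forall>n\<ge>1. p n \<le> c * real n powr (- 1 / m)" for p :: "nat \<Rightarrow> real"
  proof (rule tendsto_sandwich[OF _ _ tendsto_const u])
    show "\<forall>\<^sub>F n in sequentially. measure_pmf.prob (Pi_pmf (possible_edges n) False (\<lambda>_. bernoulli_pmf (p n)))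
      {X. \<exists>E. critical E \<and> E \<subseteq> {e \<in> possible_edges n. X e} \<and> L < card (\<Union>E)} \<le> u n"
      using q1 eventually_ge_at_top[of "1::nat"]
    proof eventually_elim
      case (elim n)
      have q0: "0 < q n" using elim A unfolding q_def by simp
      have one: "1 \<le> real n powr \<beta>" using elim b by (simp add: ge_one_powr_ge_zero)
      have Nn: "real (N n) \<le> 2 * real n powr \<beta>" using one unfolding N_def by linarith
      have NN: "real n powr \<beta> \<le> real (N n)" unfolding N_def by linarith
      have qn: "real (card overlaps) * real (card (\<Union>F) * N n) ^ card (\<Union>F) * real n powr (- \<alpha>) \<le> q n"
      proof -
        have "real (v * N n) ^ v \<le> (2 * real v * real n powr \<beta>) ^ v"
          using Nn by (intro power_mono) (simp_all add: mult_left_mono mult.assoc mult.left_commute)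
        also have "\<dots> = (2 * real v) ^ v * (real n powr \<beta>) ^ v" by (rule power_mult_distrib)
        also have "(real n powr \<beta>) ^ v = real n powr (\<alpha> / 2)"
          unfolding b(2)[symmetric] using elim by (simp add: powr_power mult.commute)
        finally have "real (card overlaps) * real (v * N n) ^ v * real n powr (- \<alpha>) \<le>
            (real (card overlaps) + 1) * ((2 * real v) ^ v * real n powr (\<alpha> / 2)) * real n powr (- \<alpha>)"
          by (intro mult_right_mono mult_mono) auto
        also have "\<dots> = A * (real n powr (\<alpha> / 2) * real n powr (- \<alpha>))" unfolding A_def by simp
        also have "\<dots> = q n" unfolding q_def powr_add[symmetric] by (simp add: field_simps)
        finally show ?thesis unfolding v_def .
      qed
      have "measure_pmf.prob (Pi_pmf (possible_edges n) False (\<lambda>_. bernoulli_pmf (p n)))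
        {X. \<exists>E. critical E \<and> E \<subseteq> {e \<in> possible_edges n. X e} \<and> L < card (\<Union>E)} \<le>
        measure_pmf.prob (Pi_pmf (possible_edges n) False (\<lambda>_. bernoulli_pmf (p n))) (exceptional n D (N n))"
      proof (rule measure_pmf.finite_measure_mono)
        show "{X. \<exists>E. critical E \<and> E \<subseteq> {e \<in> possible_edges n. X e} \<and> L < card (\<Union>E)} \<subseteq> exceptional n D (N n)"
        proof
          fix X assume "X \<in> {X. \<exists>E. critical E \<and> E \<subseteq> {e \<in> possible_edges n. X e} \<and> L < card (\<Union>E)}"
          then obtain E where E: "critical E" "E \<subseteq> {e \<in> possible_edges n. X e}" "L < card (\<Union>E)" by blast
          show "X \<in> exceptional n D (N n)"
            using critical_bounded[OF E(1,2), of D "N n"] E(3) unfolding L_def by linarith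
        qed
      qed simp
      also have "\<dots> \<le> real n ^ card (\<Union>F) * (2 * (1 / (1 / (4 * q n))) ^ D + (1 / 2) ^ N n)"
      proof (rule prob_exceptional)
        show "1 \<le> 1 / (4 * q n)" using elim q0 by (simp add: field_simps)
        show "(\<Sum>C\<in>extensions n S. p n ^ card (C - \<Union>S) * (1 / (4 * q n)) ^ excess S C) \<le> 1 / 2"
          if "(S, d) \<in> states n D i" "d < D" "i < N n" for S d i
          by (rule step_weight[OF _ _ _ c(1,2) _ al(2) qn q0 that])
            (use elim p c(3) in \<open>auto simp: M_def v_def\<close>)
      qed (use p in auto)
      also have "\<dots> = 2 * (real n ^ v * (4 * q n) ^ D) + real n ^ v * (1 / 2) ^ N n"
        unfolding v_def by (simp add: algebra_simps)
      also have "\<dots> \<le> u n"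
      proof -
        have nv: "real n ^ v = real n powr real v" using elim by (simp add: powr_realpow)
        have "(4 * q n) ^ D = (4 * A) ^ D * real n powr (- (\<alpha> / 2) * real D)"
          using elim unfolding q_def by (simp add: power_mult_distrib powr_power mult.commute)
        then have "real n ^ v * (4 * q n) ^ D = (4 * A) ^ D * (real n powr real v * real n powr (- (\<alpha> / 2) * real D))"
          unfolding nv by simp
        also have "\<dots> = (4 * A) ^ D * real n powr (real v - \<alpha> / 2 * real D)"
          unfolding powr_add[symmetric] by simp
        finally have 1: "real n ^ v * (4 * q n) ^ D = (4 * A) ^ D * real n powr (real v - \<alpha> / 2 * real D)" .
        have "(1 / 2 :: real) ^ N n = (1 / 2) powr real (N n)" by (simp add: powr_realpow)
        also have "\<dots> \<le> (1 / 2) powr (real n powr \<beta>)" using NN by (intro powr_mono') auto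
        finally have "real n ^ v * (1 / 2) ^ N n \<le> real n powr real v * (1 / 2) powr (real n powr \<beta>)"
          unfolding nv by (intro mult_left_mono) auto
        then show ?thesis unfolding u_def 1 by simp
      qed
      finally show ?case .
    qed
  qed simp
  show ?thesis using c(1) lim by blast
qed

end

subsection \<open>From edge sets back to hypergraphs\<close>

text \<open>Clears denominators in the maximal density, whose \<open>Max\<close> ranges over a
  finite set. Strictness also covers deleting vertices alone, which will exclude isolated
  vertices.\<close>

lemma subgraph_density:
  assumes "uniform_graph l F" "strictly_balanced l F"
    and J: "J \<subseteq> edges F" "\<Union>J \<subseteq> W" "W \<subseteq> verts F" "l + 1 \<le> card W"
  shows "real (card J) - 1 \<le> max_density l F * (real (card W) - real l)"
    "J \<noteq> edges F \<or> W \<noteq> verts F \<Longrightarrow> real (card J) - 1 < max_density l F * (real (card W) - real l)"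
proof -
  let ?H = "\<lparr>verts = W, edges = J\<rparr>"
  have finV: "finite (verts F)" and EV: "edges F \<subseteq> Pow (verts F)"
    using assms(1) unfolding uniform_graph_def by auto
  have sub: "subgraph ?H F" using J unfolding subgraph_def by auto
  have "{H. subgraph H F} \<subseteq> (\<lambda>(V, E). \<lparr>verts = V, edges = E\<rparr>) ` (Pow (verts F) \<times> Pow (edges F))"
  proof
    fix H assume "H \<in> {H. subgraph H F}"
    then have "(verts H, edges H) \<in> Pow (verts F) \<times> Pow (edges F)" unfolding subgraph_def by auto
    then show "H \<in> (\<lambda>(V, E). \<lparr>verts = V, edges = E\<rparr>) ` (Pow (verts F) \<times> Pow (edges F))"
      by (rule rev_image_eqI) simp
  qed
  then have "finite {H. subgraph H F}"
    using finV EV by (meson finite_Pow_iff finite_SigmaI finite_imageI finite_subset)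
  then have "finite {density l H | H. subgraph H F \<and> card (verts H) \<ge> l + 1}"
    by (rule finite_surj[of _ _ "density l"]) auto
  then have le: "density l ?H \<le> max_density l F"
    unfolding max_density_def using sub J(4) by (intro Max_ge) auto
  have pos: "0 < real (card W) - real l" using J(4) by linarith
  show "real (card J) - 1 \<le> max_density l F * (real (card W) - real l)"
    using le pos unfolding density_def by (simp add: pos_divide_le_eq)
  assume "J \<noteq> edges F \<or> W \<noteq> verts F"
  then have "?H \<noteq> F" by auto
  then have "density l ?H < max_density l F" using assms(2) sub J(4) unfolding strictly_balanced_def by auto
  then show "real (card J) - 1 < max_density l F * (real (card W) - real l)"
    using pos unfolding density_def by (simp add: pos_divide_less_eq)
qed

lemma max_intersection_bounds:
  assumes "uniform_graph l F" "1 \<le> l" "2 \<le> card (edges F)"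
  shows "max_intersection F \<le> l - 1"
    "\<exists>e1\<in>edges F. \<exists>e2\<in>edges F. e1 \<noteq> e2 \<and> card (e1 \<inter> e2) = max_intersection F"
proof -
  let ?K = "{card (e1 \<inter> e2) | e1 e2. e1 \<in> edges F \<and> e2 \<in> edges F \<and> e1 \<noteq> e2}"
  have finE: "finite (edges F)" using assms(3) by (intro card_ge_0_finite) simp
  have card: "card e = l" "finite e" if "e \<in> edges F" for e
    using that assms unfolding uniform_graph_def by (auto intro: finite_subset)
  have fin: "finite ?K"
    by (rule finite_surj[of "edges F \<times> edges F" _ "\<lambda>(a, b). card (a \<inter> b)"]) (use finE in auto)
  obtain a b where "a \<in> edges F" "b \<in> edges F" "a \<noteq> b"
    using assms(3) finE by (metis One_nat_def Suc_1 card_le_Suc0_iff_eq not_less_eq_eq)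
  then have ne: "?K \<noteq> {}" by blast
  show "\<exists>e1\<in>edges F. \<exists>e2\<in>edges F. e1 \<noteq> e2 \<and> card (e1 \<inter> e2) = max_intersection F"
    using Max_in[OF fin ne] unfolding max_intersection_def by force
  then obtain x y where xy: "x \<in> edges F" "y \<in> edges F" "x \<noteq> y" "card (x \<inter> y) = max_intersection F"
    by blast
  have "x \<inter> y \<subset> x"
  proof
    show "x \<inter> y \<noteq> x" using xy card card_subset_eq[of y x] by auto
  qed blast
  then have "card (x \<inter> y) < l" using psubset_card_mono card xy(1) by metis
  then show "max_intersection F \<le> l - 1" using xy(4) by simp
qed

text \<open>Deleting an isolated vertex would keep all edges and raise the density, so
  \<open>F\<close> has none. In the tight case, two edges sharing \<open>l - 1\<close> vertices span
  a subgraph of density 1, which gives \<open>1 \<le> m\<close>.\<close>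

lemma strictly_balanced_family:
  assumes l: "1 \<le> l" and U: "uniform_graph l F" and B: "strictly_balanced l F"
    and e: "(card (edges F) = 3 \<and> max_intersection F = l - 1) \<or> card (edges F) \<ge> 4"
  shows "\<Union>(edges F) = verts F"
    "balanced_family l (edges F) (max_density l F) (max_intersection F = l - 1)"
proof -
  let ?m = "max_density l F"
  have finV: "finite (verts F)" and EV: "\<Union>(edges F) \<subseteq> verts F"
    using U unfolding uniform_graph_def by auto
  have card: "card f = l" "finite f" if "f \<in> edges F" for f
    using that U finV unfolding uniform_graph_def by (auto intro: finite_subset)
  have e3: "3 \<le> card (edges F)" using e by auto
  have v: "l + 1 \<le> card (verts F)" using B unfolding strictly_balanced_def by simp
  have dens: "real (card (edges F)) - 1 = ?m * (real (card (verts F)) - real l)"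
    using B v unfolding strictly_balanced_def density_def by simp
  have m: "0 < ?m"
  proof -
    have "0 < ?m * (real (card (verts F)) - real l)" using dens e3 by linarith
    then show ?thesis using v by (simp add: zero_less_mult_iff)
  qed
  have finU: "finite (\<Union>J)" if "J \<subseteq> edges F" for J
    using that EV finV by (meson Union_mono finite_subset)
  \<comment> \<open>The density bound applies only above \<open>l\<close> vertices, which any two
    distinct edges span.\<close>
  have big: "l + 1 \<le> card (\<Union>J)" if J: "J \<subseteq> edges F" "2 \<le> card J" for J
  proof (rule ccontr)
    assume "\<not> l + 1 \<le> card (\<Union>J)"
    then have "f = \<Union>J" if "f \<in> J" for f
      using that card J finU[OF J(1)] by (intro card_seteq) auto
    then have "J \<subseteq> {\<Union>J}" by blast
    then have "card J \<le> card {\<Union>J}" by (intro card_mono) auto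
    then show False using J(2) by simp
  qed
  have sub: "\<Union>J \<subseteq> verts F" if "J \<subseteq> edges F" for J using that EV by blast
  show span: "\<Union>(edges F) = verts F"
  proof (rule ccontr)
    assume ne: "\<Union>(edges F) \<noteq> verts F"
    have "real (card (edges F)) - 1 < ?m * (real (card (\<Union>(edges F))) - real l)"
      using subgraph_density(2)[OF U B order_refl order_refl EV] big[OF order_refl] ne e3 by simp
    also have "\<dots> \<le> ?m * (real (card (verts F)) - real l)"
      using m card_mono[OF finV EV] by simp
    finally show False using dens by simp
  qed
  show "balanced_family l (edges F) ?m (max_intersection F = l - 1)"
  proof
    show "real (card J) - 1 \<le> ?m * (real (card (\<Union>J)) - real l)" if J: "J \<subseteq> edges F" "J \<noteq> {}" for J
    proof (cases "2 \<le> card J")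
      case True
      then show ?thesis using subgraph_density(1)[OF U B J(1) order_refl sub[OF J(1)] big[OF J(1)]] by simp
    next
      case False
      obtain f where f: "f \<in> J" using J by blast
      have "l \<le> card (\<Union>J)" using card[of f] f J finU[OF J(1)] by (metis Union_upper card_mono subsetD)
      then have "0 \<le> ?m * (real (card (\<Union>J)) - real l)" using m by simp
      then show ?thesis using False by linarith
    qed
    show "real (card J) - 1 < ?m * (real (card (\<Union>J)) - real l)" if J: "J \<subset> edges F" "2 \<le> card J" for J
      using subgraph_density(2)[OF U B _ order_refl sub big] J by auto
    show "1 \<le> ?m" if t: "max_intersection F = l - 1"
    proof -
      obtain x y where xy: "x \<in> edges F" "y \<in> edges F" "x \<noteq> y" "card (x \<inter> y) = l - 1"
        using max_intersection_bounds(2)[OF U l] e3 t by auto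
      have "card (x \<union> y) + card (x \<inter> y) = l + l" using card_Un_Int[of x y] card xy by simp
      then have "card (x \<union> y) = l + 1" using xy l by simp
      then show ?thesis
        using subgraph_density(1)[OF U B, of "{x, y}" "\<Union>{x, y}"] sub[of "{x, y}"] xy by simp
    qed
  qed (use l card m dens span e e3 in auto)
qed

text \<open>Since \<open>F\<close> has no isolated vertices, a copy is determined by its edges. So
  \<open>edges\<close> is a bijection from \<open>copies F B\<close> to
  \<open>copies_in (edges B)\<close>, and all notions carry over.\<close>

lemma block_critical:
  fixes F :: "'a hypergraph" and B :: "nat hypergraph"
  assumes fam: "balanced_family l (edges F) m (max_intersection F = l - 1)"
    and span: "\<Union>(edges F) = verts F" and mi: "max_intersection F \<le> l - 1"
    and B: "block l F B"
  shows "verts B = \<Union>(edges B)" "edges B \<noteq> {} \<Longrightarrow> balanced_family.critical (edges F) (max_intersection F = l - 1) (edges B)"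
proof -
  interpret balanced_family l "edges F" m "max_intersection F = l - 1" by (rule fam)
  have BV: "\<Union>(edges B) \<subseteq> verts B" using B unfolding block_def uniform_graph_def by auto
  have iso: "H = \<lparr>verts = \<Union>(edges H), edges = edges H\<rparr> \<and> is_copy (edges H)" if H: "isomorphic F H" for H :: "nat hypergraph"
  proof -
    obtain f where f: "bij_betw f (verts F) (verts H)" "edges H = (`) f ` edges F"
      using H unfolding isomorphic_def by blast
    have "\<Union>(edges H) = f ` \<Union>(edges F)" using f(2) by blast
    then have "\<Union>(edges H) = verts H" using f(1) span unfolding bij_betw_def by simp
    moreover have "is_copy (edges H)" using f span unfolding is_copy_def bij_betw_def by auto
    ultimately show ?thesis by simp
  qed
  have inj: "inj_on edges (copies F B)"
    by (intro inj_onI) (metis (mono_tags, lifting) copies_def iso mem_Collect_eq)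
  have im: "edges ` copies F B = copies_in (edges B)"
  proof
    show "edges ` copies F B \<subseteq> copies_in (edges B)"
      using iso unfolding copies_def copies_in_def subgraph_def by auto
    show "copies_in (edges B) \<subseteq> edges ` copies F B"
    proof
      fix K assume "K \<in> copies_in (edges B)"
      then have K: "K \<subseteq> edges B" "is_copy K" unfolding copies_in_def by auto
      obtain \<phi> where \<phi>: "inj_on \<phi> (\<Union>(edges F))" "K = (`) \<phi> ` edges F"
        using K(2) unfolding is_copy_def by auto
      have "\<phi> ` \<Union>(edges F) = \<Union>K" using \<phi>(2) by blast
      then have "isomorphic F \<lparr>verts = \<Union>K, edges = K\<rparr>"
        unfolding isomorphic_def using \<phi> span by (auto simp: bij_betw_def)
      moreover have "subgraph \<lparr>verts = \<Union>K, edges = K\<rparr> B"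
        using K BV unfolding subgraph_def by auto
      ultimately show "K \<in> edges ` copies F B" unfolding copies_def
        by (intro image_eqI[of _ _ "\<lparr>verts = \<Union>K, edges = K\<rparr>"]) auto
    qed
  qed
  have cnt: "card {H \<in> copies F B. e \<in> edges H} = card {K \<in> copies_in (edges B). e \<in> K}" for e
  proof -
    have "{K \<in> copies_in (edges B). e \<in> K} = edges ` {H \<in> copies F B. e \<in> edges H}"
      unfolding im[symmetric] by blast
    moreover have "inj_on edges {H \<in> copies F B. e \<in> edges H}"
      by (rule inj_on_subset[OF inj]) blast
    ultimately show ?thesis by (simp add: card_image)
  qed
  have equiv: "equivalent_edges F B e1 e2 \<longleftrightarrow>
      e1 \<in> edges B \<and> e2 \<in> edges B \<and> (\<forall>K\<in>copies_in (edges B). e1 \<in> K \<longleftrightarrow> e2 \<in> K)" for e1 e2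
    unfolding equivalent_edges_def im[symmetric] by simp
  \<comment> \<open>By \<open>mi\<close>, not being tight is the same as
    \<open>max_intersection F < l - 1\<close>.\<close>
  have ce: "closed_edge l F B e \<longleftrightarrow> closed_in (edges B) e" for e
    unfolding closed_edge_def closed_in_def cnt equiv using mi by auto
  have clB: "closed_graph l F B" using B unfolding block_def by simp
  have cc: "copy_closed_in (edges B) (edges H)" if "H \<in> copies F B" for H
    using clB that unfolding closed_graph_def closed_copy_def copy_closed_in_def ce by blast
  show "verts B = \<Union>(edges B)"
  proof
    show "verts B \<subseteq> \<Union>(edges B)"
    proof
      fix x assume "x \<in> verts B"
      then obtain H where H: "H \<in> copies F B" "x \<in> verts H" using clB unfolding closed_graph_def by blast
      have "verts H = \<Union>(edges H)" using iso[of H] H(1) unfolding copies_def by (metis (mono_tags, lifting) hypergraph.select_convs(1) mem_Collect_eq)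
      moreover have "edges H \<subseteq> edges B" using H unfolding copies_def subgraph_def by auto
      ultimately show "x \<in> \<Union>(edges B)" using H(2) by blast
    qed
  qed (rule BV)
  assume "edges B \<noteq> {}"
  then have "copies F B \<noteq> {}" using clB unfolding closed_graph_def by blast
  moreover have "\<exists>K\<in>copies_in (edges B). K \<inter> E' \<noteq> {} \<and> K - E' \<noteq> {}"
    if "E' \<noteq> {}" "E' \<subset> edges B" for E'
    using B that unfolding block_def im[symmetric] by blast
  ultimately show "critical (edges B)" unfolding critical_def using cc im[symmetric] by auto
qed

theorem theorem12:
  fixes l :: nat and F :: "'a hypergraph"
  assumes "l \<ge> 2"
    and "uniform_graph l F"
    and "strictly_balanced l F"
    and "(card (edges F) = 3 \<and> max_intersection F = l - 1) \<or> card (edges F) \<ge> 4"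
  shows "\<exists>c L :: real. c > 0 \<and> L > 0 \<and>
    (\<forall>p :: nat \<Rightarrow> real.
       (\<forall>n. 0 \<le> p n \<and> p n \<le> 1) \<and>
       (\<forall>n\<ge>1. p n \<le> c * real n powr (- 1 / max_density l F)) \<longrightarrow>
       (\<lambda>n. measure_pmf.prob (random_graph l n (p n))
              {G. \<forall>B. subgraph B G \<and> block l F B \<longrightarrow> real (card (verts B)) \<le> L})
         \<longlonglongrightarrow> 1)"
proof -
  have l: "1 \<le> l" using assms(1) by simp
  note span = strictly_balanced_family(1)[OF l assms(2-4)]
  note fam = strictly_balanced_family(2)[OF l assms(2-4)]
  have mi: "max_intersection F \<le> l - 1"
    using assms(4) by (intro max_intersection_bounds(1)[OF assms(2) l]) auto
  interpret balanced_family l "edges F" "max_density l F" "max_intersection F = l - 1" by (rule fam)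
  obtain c L where c: "0 < c" and lim: "\<And>p. (\<forall>n. 0 \<le> p n \<and> p n \<le> 1) \<and>
      (\<forall>n\<ge>1. p n \<le> c * real n powr (- 1 / max_density l F)) \<Longrightarrow>
    (\<lambda>n. measure_pmf.prob (Pi_pmf (possible_edges n) False (\<lambda>_. bernoulli_pmf (p n)))
      {X. \<exists>E. critical E \<and> E \<subseteq> {e \<in> possible_edges n. X e} \<and> L < card (\<Union>E)}) \<longlonglongrightarrow> 0"
    using critical_bounded_whp by blast
  \<comment> \<open>\<open>L\<close> is a natural number and may be 0; adding 1 makes the bound
    positive.\<close>
  have "(\<lambda>n. measure_pmf.prob (random_graph l n (p n))
      {G. \<forall>B. subgraph B G \<and> block l F B \<longrightarrow> real (card (verts B)) \<le> real L + 1}) \<longlonglongrightarrow> 1"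
    if p: "(\<forall>n. 0 \<le> p n \<and> p n \<le> 1) \<and> (\<forall>n\<ge>1. p n \<le> c * real n powr (- 1 / max_density l F))" for p
  proof (rule tendsto_sandwich[OF _ _ _ tendsto_const])
    let ?M = "\<lambda>n. Pi_pmf (possible_edges n) False (\<lambda>_. bernoulli_pmf (p n))"
    let ?bad = "\<lambda>n. {X. \<exists>E. critical E \<and> E \<subseteq> {e \<in> possible_edges n. X e} \<and> L < card (\<Union>E)}"
    let ?good = "{G. \<forall>B. subgraph B G \<and> block l F B \<longrightarrow> real (card (verts B)) \<le> real L + 1}"
    have "1 - measure_pmf.prob (?M n) (?bad n) \<le> measure_pmf.prob (random_graph l n (p n)) ?good" for n
    proof -
      let ?G = "\<lambda>X. \<lparr>verts = {..<n}, edges = {e \<in> possible_edges n. X e}\<rparr>"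
      have rg: "random_graph l n (p n) = map_pmf ?G (?M n)"
        unfolding random_graph_def possible_edges_def Let_def ..
      have "- ?bad n \<subseteq> ?G -` ?good"
      proof
        fix X assume X: "X \<in> - ?bad n"
        have "card (verts B) \<le> L" if S: "subgraph B (?G X)" "block l F B" for B
        proof (cases "edges B = {}")
          case False
          have "edges B \<subseteq> {e \<in> possible_edges n. X e}" using S(1) unfolding subgraph_def by simp
          then have "\<not> L < card (\<Union>(edges B))"
            using X block_critical(2)[OF fam span mi S(2) False] by blast
          then show ?thesis using block_critical(1)[OF fam span mi S(2)] by simp
        \<comment> \<open>A block without edges has no vertices.\<close>
        qed (use block_critical(1)[OF fam span mi S(2)] in simp)
        then show "X \<in> ?G -` ?good" by fastforce
      qed
      then have "measure_pmf.prob (?M n) (- ?bad n) \<le> measure_pmf.prob (?M n) (?G -` ?good)"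
        by (intro measure_pmf.finite_measure_mono) auto
      then show ?thesis unfolding rg measure_map_pmf
        using measure_pmf.prob_compl[of "?bad n" "?M n"] by (simp add: Compl_eq_Diff_UNIV)
    qed
    then show "\<forall>\<^sub>F n in sequentially. 1 - measure_pmf.prob (?M n) (?bad n) \<le>
        measure_pmf.prob (random_graph l n (p n)) ?good" by simp
    show "(\<lambda>n. 1 - measure_pmf.prob (?M n) (?bad n)) \<longlonglongrightarrow> 1"
      using tendsto_diff[OF tendsto_const lim[OF p], of 1] by simp
  qed simp
  then have "\<forall>p :: nat \<Rightarrow> real. (\<forall>n. 0 \<le> p n \<and> p n \<le> 1) \<and>
      (\<forall>n\<ge>1. p n \<le> c * real n powr (- 1 / max_density l F)) \<longrightarrow>
    (\<lambda>n. measure_pmf.prob (random_graph l n (p n))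
      {G. \<forall>B. subgraph B G \<and> block l F B \<longrightarrow> real (card (verts B)) \<le> real L + 1}) \<longlonglongrightarrow> 1"
    by (intro allI impI)
  moreover have "0 < real L + 1" by simp
  ultimately show ?thesis using c by blast
qed

end
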